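(* Let $k$ be an arbitrary field, let $n\ge 1$ be an integer prime to $\mathrm{char}\,k$, and let $u\in k^{\times}$ be such that $u\notin\mu(k)_p\,(k^{\times})^p$ for every prime $p\mid n$. Then the polynomial $x^n-u$ is irreducible over $k$, and for $t=\sqrt[n]{u}$ we have $$k(t)\cap k^{\mathrm{ab}}=k(t^m)\quad\text{where}\quad m=\frac{n}{\prod_{p\mid n}\gcd(n,p^{\lambda(k)_p})},$$ the product being over the primes $p$ dividing $n$, with the convention that $\gcd(n,p^{\infty})$ is the $p$-primary component of $n$.
   Context: For a field $k$, $k^{\mathrm{ab}}$ is the maximal abelian extension of $k$, and $\mu(k)$ is the group of all roots of unity in $k$. For a prime $p\ne\mathrm{char}\,k$, $\mu(k)_p$ is the subgroup of $\mu(k)$ of elements $x$ satisfying $x^{p^d}=1$ for some $d\ge 0$. If $\mu(k)_p$ is finite, $\lambda(k)_p$ is the non-negative integer with $|\mu(k)_p|=p^{\lambda(k)_p}$; otherwise $\lambda(k)_p=\infty$. For $u\in k^\times$, $\sqrt[n]{u}$ denotes an arbitrary root of $x^n-u$ (in a fixed algebraic closure of $k$ that also contains $k^{\mathrm{ab}}$). If an integer $n=p^e m'$ with $p\nmid m'$, then $p^e$ is the $p$-primary component of $n$. In characteristic $0$ every $n\geq 1$ is considered prime to $\mathrm{char}\,k$. *)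

theory Defs
  imports "HOL-Algebra.Algebraic_Closure_Type" "HOL-Algebra.Generated_Fields" "HOL-Algebra.QuotRing"
    "HOL-Library.Extended_Nat"
begin

text \<open>
  The field \<open>k\<close> is a type \<open>'a :: field\<close>, and the fixed algebraic closure is \<open>'a alg_closure\<close>, into
  which \<open>k\<close> is embedded by \<open>to_ac\<close>. The intermediate fields are subsets of \<open>'a alg_closure\<close>;
  \<open>ring_of_type_algebra\<close> presents that type as a ring record, so that the notions of subfield,
  generated subfield and ring isomorphism of HOL-Algebra apply to them.
\<close>

definition roots_of_unity :: "'a::field set" where
  "roots_of_unity = {x. \<exists>n\<ge>1. x ^ n = 1}"

definition primary_roots_of_unity :: "nat \<Rightarrow> 'a::field set" where
  "primary_roots_of_unity p = {x \<in> roots_of_unity. \<exists>d. x ^ (p ^ d) = 1}"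

definition lambda_exponent :: "'a::field itself \<Rightarrow> nat \<Rightarrow> enat" where
  "lambda_exponent _ p =
     (if finite (primary_roots_of_unity p :: 'a set)
      then enat (THE l. card (primary_roots_of_unity p :: 'a set) = p ^ l)
      else \<infinity>)"

text \<open>
  \<open>gcd_prime_power n p l\<close> is \<open>gcd(n, p\<^sup>l)\<close>, where \<open>gcd(n, p\<^sup>\<infinity>)\<close> is the \<open>p\<close>-primary component of \<open>n\<close>.
\<close>

definition gcd_prime_power :: "nat \<Rightarrow> nat \<Rightarrow> enat \<Rightarrow> nat" where
  "gcd_prime_power n p l =
     (case l of enat j \<Rightarrow> gcd n (p ^ j) | \<infinity> \<Rightarrow> p ^ multiplicity p n)"

text \<open>
  The factors below are powers of distinct primes and each of them divides \<open>n\<close>, so the division of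
  natural numbers is exact.
\<close>

definition kummer_index :: "'a::field itself \<Rightarrow> nat \<Rightarrow> nat" where
  "kummer_index k n =
     n div (\<Prod>p | Factorial_Ring.prime p \<and> p dvd n. gcd_prime_power n p (lambda_exponent k p))"

definition adjoin :: "'a::field alg_closure \<Rightarrow> 'a alg_closure set" where
  "adjoin t = generate_field ring_of_type_algebra (insert t (range to_ac))"

definition intermediate_field :: "'a::field alg_closure set \<Rightarrow> bool" where
  "intermediate_field L \<longleftrightarrow> subfield L ring_of_type_algebra \<and> range to_ac \<subseteq> L"

text \<open>
  The automorphisms of \<open>L\<close> over \<open>k\<close>, represented by functions on the whole closure; their values
  outside \<open>L\<close> are irrelevant.
\<close>

definition automorphisms_over :: "'a::field alg_closure set \<Rightarrow> ('a alg_closure \<Rightarrow> 'a alg_closure) set" where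
  "automorphisms_over L =
     {\<sigma> \<in> ring_iso (ring_of_type_algebra\<lparr>carrier := L\<rparr>) (ring_of_type_algebra\<lparr>carrier := L\<rparr>).
        \<forall>c. \<sigma> (to_ac c) = to_ac c}"

text \<open>
  A Galois extension of \<open>k\<close> (possibly infinite) is, following Artin, an algebraic extension in which
  the fixed field of the automorphisms over \<open>k\<close> is \<open>k\<close>. Algebraicity needs no hypothesis here: all of
  \<open>'a alg_closure\<close> is algebraic over \<open>k\<close>, by \<open>alg_closure_algebraic\<close>.
\<close>

definition galois_extension :: "'a::field alg_closure set \<Rightarrow> bool" where
  "galois_extension L \<longleftrightarrow>
     intermediate_field L \<and> {x \<in> L. \<forall>\<sigma>\<in>automorphisms_over L. \<sigma> x = x} = range to_ac"

definition abelian_extension :: "'a::field alg_closure set \<Rightarrow> bool" where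
  "abelian_extension L \<longleftrightarrow>
     galois_extension L \<and>
     (\<forall>\<sigma>\<in>automorphisms_over L. \<forall>\<tau>\<in>automorphisms_over L. \<forall>x\<in>L. \<sigma> (\<tau> x) = \<tau> (\<sigma> x))"

text \<open>The maximal abelian extension, as the compositum of all abelian extensions of \<open>k\<close>.\<close>

definition maximal_abelian_extension :: "'a::field alg_closure set" where
  "maximal_abelian_extension = generate_field ring_of_type_algebra (\<Union>{L. abelian_extension L})"

end

theory Submission
  imports Defs
begin

text \<open>
  A monic divisor of \<open>x ^ n - u\<close> of degree \<open>r\<close> over a field \<open>L\<close> has constant term \<open>\<plusminus> z * t ^ r\<close>
  with \<open>z ^ n = 1\<close>. For \<open>L = k\<close>, raising it to the power \<open>n\<close> shows that \<open>u ^ r\<close> is, up to sign, an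
  \<open>n\<close>-th power, so that \<open>u\<close> lies in \<open>\<mu>\<^sub>p k\<^sup>p\<close> for some \<open>p\<close> if \<open>0 < r < n\<close>; hence irreducibility.
  For \<open>L = k(t) \<inter> k\<^sup>a\<^sup>b\<close> and \<open>r = [k(t) : L]\<close> it shows \<open>t ^ r \<in> k\<^sup>a\<^sup>b\<close>, since roots of unity are abelian
  over \<open>k\<close>. A commutator argument (Schinzel) bounds the degree of such a radical: if \<open>s ^ p ^ f = u\<close>
  and \<open>s \<in> k\<^sup>a\<^sup>b\<close>, then \<open>f \<le> \<lambda>(k)\<^sub>p\<close>. So \<open>m\<close> divides \<open>r\<close>. As \<open>t ^ m \<in> L\<close> by Kummer theory,
  \<open>x ^ m - t ^ m\<close> is the minimal polynomial of \<open>t\<close> over \<open>L\<close>, and comparing coefficients with respect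
  to the powers of \<open>t\<close> gives \<open>L = k(t ^ m)\<close>.
\<close>

section \<open>Extending homomorphisms\<close>

text \<open>Graphs of homomorphisms over \<open>k\<close> between subrings of the closure. By algebraicity these
  subrings are fields, and the graph \<open>Id_on K\<close> stands for an intermediate field \<open>K\<close> itself, so that
  polynomials over \<open>K\<close> and pairs of polynomials conjugate under a homomorphism are treated alike.\<close>

definition partial_hom :: "('a::field alg_closure \<times> 'a alg_closure) set \<Rightarrow> bool" where
  "partial_hom G \<longleftrightarrow>
     (\<forall>c. (to_ac c, to_ac c) \<in> G) \<and>
     (\<forall>a b a' b'. (a, b) \<in> G \<longrightarrow> (a', b') \<in> G \<longrightarrow> (a + a', b + b') \<in> G \<and> (a * a', b * b') \<in> G) \<and>
     (\<forall>b. (0, b) \<in> G \<longrightarrow> b = 0)"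

definition coeffs_rel :: "('a::zero \<times> 'a) set \<Rightarrow> 'a poly \<Rightarrow> 'a poly \<Rightarrow> bool" where
  "coeffs_rel G P Q \<longleftrightarrow> (\<forall>i. (Polynomial.coeff P i, Polynomial.coeff Q i) \<in> G)"

lemma partial_hom_const: "partial_hom G \<Longrightarrow> (to_ac c, to_ac c) \<in> G"
  and partial_hom_add: "partial_hom G \<Longrightarrow> (a, b) \<in> G \<Longrightarrow> (a', b') \<in> G \<Longrightarrow> (a + a', b + b') \<in> G"
  and partial_hom_mult: "partial_hom G \<Longrightarrow> (a, b) \<in> G \<Longrightarrow> (a', b') \<in> G \<Longrightarrow> (a * a', b * b') \<in> G"
  and partial_hom_zeroD: "partial_hom G \<Longrightarrow> (0, b) \<in> G \<Longrightarrow> b = 0"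
  by (auto simp: partial_hom_def)

lemma partial_hom_0: "partial_hom G \<Longrightarrow> (0, 0) \<in> G"
  and partial_hom_1: "partial_hom G \<Longrightarrow> (1, 1) \<in> G"
  using partial_hom_const[of G 0] partial_hom_const[of G 1] by auto

lemma partial_hom_uminus: "partial_hom G \<Longrightarrow> (a, b) \<in> G \<Longrightarrow> (- a, - b) \<in> G"
  using partial_hom_mult[OF _ partial_hom_const[of G "-1"], of a b] by simp

lemma partial_hom_diff: "partial_hom G \<Longrightarrow> (a, b) \<in> G \<Longrightarrow> (a', b') \<in> G \<Longrightarrow> (a - a', b - b') \<in> G"
  using partial_hom_add[of G a b "-a'" "-b'"] partial_hom_uminus by auto

text \<open>Single-valuedness reduces to the zero clause of \<open>partial_hom\<close>: two pairs
  with the same first entry differ by a partner of 0.\<close>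

lemma partial_hom_unique: "partial_hom G \<Longrightarrow> (a, b) \<in> G \<Longrightarrow> (a, b') \<in> G \<Longrightarrow> b = b'"
  using partial_hom_diff[of G a b a b'] partial_hom_zeroD[of G "b - b'"] by simp

text \<open>Both polynomials lose their constant coefficients in step. When the first is used up,
  every coefficient of the second is a partner of 0 and hence 0.\<close>

lemma coeffs_rel_induct [consumes 2, case_names zero pCons]:
  assumes "partial_hom G" "coeffs_rel G P Q"
    and "R 0 0"
    and "\<And>a b P Q. (a, b) \<in> G \<Longrightarrow> coeffs_rel G P Q \<Longrightarrow> R P Q \<Longrightarrow> R (pCons a P) (pCons b Q)"
  shows "R P Q"
  using assms(2)
proof (induction P arbitrary: Q)
  case 0
  have "Q = 0"
    using 0 partial_hom_zeroD[OF assms(1)] by (intro poly_eqI) (auto simp: coeffs_rel_def)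
  then show ?case using assms(3) by simp
next
  case (pCons a P)
  obtain b Q' where Q: "Q = pCons b Q'" by (cases Q)
  have "(a, b) \<in> G" using pCons.prems[unfolded coeffs_rel_def, rule_format, of 0] by (simp add: Q)
  moreover have "coeffs_rel G P Q'"
    unfolding coeffs_rel_def
    using pCons.prems[unfolded coeffs_rel_def, rule_format, of "Suc _"] by (simp add: Q)
  ultimately show ?case using pCons.IH assms(4) Q by blast
qed

section \<open>Arithmetic of related polynomials\<close>

context
  fixes G :: "('a::field alg_closure \<times> 'a alg_closure) set"
  assumes G: "partial_hom G"
begin

lemma coeffs_rel_0: "coeffs_rel G 0 0"
  using partial_hom_0[OF G] by (simp add: coeffs_rel_def)

lemma coeffs_rel_pCons: "(a, b) \<in> G \<Longrightarrow> coeffs_rel G P Q \<Longrightarrow> coeffs_rel G (pCons a P) (pCons b Q)"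
  by (auto simp: coeffs_rel_def coeff_pCons split: nat.split)

lemma coeffs_rel_add: "coeffs_rel G P Q \<Longrightarrow> coeffs_rel G P' Q' \<Longrightarrow> coeffs_rel G (P + P') (Q + Q')"
  using partial_hom_add[OF G] by (simp add: coeffs_rel_def)

lemma coeffs_rel_diff: "coeffs_rel G P Q \<Longrightarrow> coeffs_rel G P' Q' \<Longrightarrow> coeffs_rel G (P - P') (Q - Q')"
  using partial_hom_diff[OF G] by (simp add: coeffs_rel_def)

lemma coeffs_rel_smult: "(a, b) \<in> G \<Longrightarrow> coeffs_rel G P Q \<Longrightarrow> coeffs_rel G (smult a P) (smult b Q)"
  using partial_hom_mult[OF G] by (simp add: coeffs_rel_def)

lemma coeffs_rel_monom: "(a, b) \<in> G \<Longrightarrow> coeffs_rel G (Polynomial.monom a n) (Polynomial.monom b n)"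
  using partial_hom_0[OF G] by (simp add: coeffs_rel_def)

lemma coeffs_rel_mult: "coeffs_rel G P Q \<Longrightarrow> coeffs_rel G P' Q' \<Longrightarrow> coeffs_rel G (P * P') (Q * Q')"
proof (induction P Q rule: coeffs_rel_induct[OF G, consumes 1, case_names zero pCons])
  case zero
  then show ?case using coeffs_rel_0 by simp
next
  case (pCons a b P Q)
  then show ?case
    using coeffs_rel_add[OF coeffs_rel_smult coeffs_rel_pCons[OF partial_hom_0[OF G]]]
    by simp
qed

lemma coeffs_rel_poly: "coeffs_rel G P Q \<Longrightarrow> (x, y) \<in> G \<Longrightarrow> (poly P x, poly Q y) \<in> G"
proof (induction P Q rule: coeffs_rel_induct[OF G, consumes 1, case_names zero pCons])
  case zero
  then show ?case using partial_hom_0[OF G] by simp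
next
  case (pCons a b P Q)
  then show ?case using partial_hom_add[OF G] partial_hom_mult[OF G] by simp
qed

lemma coeffs_rel_to_ac: "coeffs_rel G (map_poly to_ac p) (map_poly to_ac p)"
  using partial_hom_const[OF G] by (simp add: coeffs_rel_def coeff_map_poly)

lemma coeffs_rel_prod:
  "(\<And>i. i \<in> A \<Longrightarrow> coeffs_rel G (P i) (Q i)) \<Longrightarrow> coeffs_rel G (\<Prod>i\<in>A. P i) (\<Prod>i\<in>A. Q i)"
proof (induction A rule: infinite_finite_induct)
  case (insert x F)
  then show ?case using coeffs_rel_mult by simp
qed (use coeffs_rel_to_ac[of 1] in auto)

end

text \<open>An equation for \<open>x\<close> over \<open>k\<close> either has constant term 0, so
  that \<open>x\<close> can be cancelled, or can be divided by its constant term. So inverses are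
  polynomial values, which is what makes subrings of the closure over \<open>k\<close>
  fields.\<close>

lemma inverse_as_poly:
  fixes x :: "'a::field alg_closure"
  assumes "x \<noteq> 0"
  obtains r :: "'a poly" where "x * poly (map_poly to_ac r) x = 1"
proof -
  obtain p :: "'a poly" where p: "p \<noteq> 0" "poly (map_poly to_ac p) x = 0"
    using alg_closure_algebraic .
  from p obtain r where "x * poly (map_poly to_ac r) x = 1"
  proof (induction p arbitrary: thesis)
    case (pCons c p)
    have eq: "to_ac c + x * poly (map_poly to_ac p) x = 0"
      using pCons.prems by (simp add: map_poly_pCons)
    show ?case
    proof (cases "c = 0")
      case True
      then show ?thesis using pCons eq assms by auto
    next
      case False
      have *: "map_poly to_ac (smult (- inverse c) p) = smult (to_ac (- inverse c)) (map_poly to_ac p)"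
        by (intro poly_eqI) (simp add: coeff_map_poly)
      have "x * poly (map_poly to_ac (smult (- inverse c) p)) x = 1"
      proof -
        have "x * poly (map_poly to_ac p) x = - to_ac c" using eq by (simp add: add_eq_0_iff)
        then have "to_ac (- inverse c) * (x * poly (map_poly to_ac p) x) = 1"
          using False by (simp flip: to_ac_inverse to_ac_mult)
        then show ?thesis unfolding * by (simp add: mult.left_commute)
      qed
      then show ?thesis using pCons.prems by blast
    qed
  qed auto
  then show ?thesis using that by blast
qed

lemma partial_hom_inverse:
  assumes "partial_hom G" "(x, y) \<in> G"
  shows "(inverse x, inverse y) \<in> G"
proof (cases "x = 0")
  case True
  then show ?thesis using assms partial_hom_zeroD partial_hom_0 by force
next
  case False
  obtain r :: "'a poly" where r: "x * poly (map_poly to_ac r) x = 1"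
    using inverse_as_poly[OF False] .
  have rel: "(poly (map_poly to_ac r) x, poly (map_poly to_ac r) y) \<in> G"
    using coeffs_rel_poly[OF assms(1) coeffs_rel_to_ac[OF assms(1)] assms(2)] .
  then have "(1, y * poly (map_poly to_ac r) y) \<in> G"
    using partial_hom_mult[OF assms rel] r by simp
  then have "y * poly (map_poly to_ac r) y = 1"
    using partial_hom_unique[OF assms(1)] partial_hom_1[OF assms(1)] by blast
  then show ?thesis using rel r by (metis inverse_unique)
qed

text \<open>Inverses make homomorphisms injective: a nonzero \<open>x\<close> with partner 0 would
  put (1, 0) into \<open>G\<close>.\<close>

lemma partial_hom_eq_0_iff:
  assumes "partial_hom G" "(x, y) \<in> G"
  shows "x = 0 \<longleftrightarrow> y = 0"
proof -
  have "(x * inverse x, y * inverse y) \<in> G"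
    using assms partial_hom_inverse partial_hom_mult by blast
  moreover have "(1, 0) \<notin> G"
    using partial_hom_unique[OF assms(1) partial_hom_1[OF assms(1)], of 0] by auto
  ultimately show ?thesis
    using assms partial_hom_zeroD by (cases "x = 0"; cases "y = 0") auto
qed

section \<open>Division with remainder and minimal polynomials\<close>

lemma coeffs_rel_degree:
  assumes "partial_hom G" "coeffs_rel G P Q"
  shows "Polynomial.degree P = Polynomial.degree Q"
proof -
  have "Polynomial.coeff P i = 0 \<longleftrightarrow> Polynomial.coeff Q i = 0" for i
    using partial_hom_eq_0_iff[OF assms(1), of "Polynomial.coeff P i" "Polynomial.coeff Q i"] assms(2)
    by (simp add: coeffs_rel_def)
  then show ?thesis unfolding Polynomial.degree_def by simp
qed

text \<open>\<open>F\<close> is the minimal polynomial of \<open>y\<close> over the domain of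
  \<open>G\<close>, and \<open>F'\<close> its image under the homomorphism. Minimality appears as
  divisibility with related cofactors, because that transfers the vanishing of \<open>P\<close> at
  \<open>y\<close> to the vanishing of \<open>Q\<close> at a root of \<open>F'\<close>.\<close>

definition minimal_pair where
  "minimal_pair G y F F' \<longleftrightarrow>
     coeffs_rel G F F' \<and> Polynomial.lead_coeff F = 1 \<and> poly F y = 0 \<and>
     (\<forall>P Q. coeffs_rel G P Q \<longrightarrow> poly P y = 0 \<longrightarrow> (\<exists>A B. coeffs_rel G A B \<and> P = F * A \<and> Q = F' * B))"

text \<open>Long division by a monic polynomial, carried out on both sides of the relation at once;
  the degree of \<open>P\<close> drives the recursion.\<close>

lemma coeffs_rel_division:
  assumes G: "partial_hom G" and F: "coeffs_rel G F F'" "Polynomial.lead_coeff F = 1"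
    "Polynomial.degree F > 0"
    and PQ: "coeffs_rel G P Q"
  shows "\<exists>A B R S. coeffs_rel G A B \<and> coeffs_rel G R S \<and> P = F * A + R \<and> Q = F' * B + S \<and>
           Polynomial.degree R < Polynomial.degree F"
  using PQ
proof (induction "Polynomial.degree P" arbitrary: P Q rule: less_induct)
  case less
  show ?case
  proof (cases "Polynomial.degree P < Polynomial.degree F")
    case True
    then show ?thesis using less.prems coeffs_rel_0[OF G]
      by (intro exI[of _ 0] exI[of _ P] exI[of _ Q]) auto
  next
    case False
    define e where "e = Polynomial.degree P - Polynomial.degree F"
    let ?M = "Polynomial.monom (Polynomial.lead_coeff P) e"
    \<comment> \<open>Read off at the degree of \<open>P\<close>, this coefficient is by definition
      the partner of the leading coefficient of \<open>P\<close>.\<close>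
    let ?N = "Polynomial.monom (Polynomial.coeff Q (Polynomial.degree P)) e"
    have MN: "coeffs_rel G ?M ?N"
      using less.prems by (intro coeffs_rel_monom[OF G]) (auto simp: coeffs_rel_def)
    have rel: "coeffs_rel G (P - F * ?M) (Q - F' * ?N)"
      by (intro coeffs_rel_diff coeffs_rel_mult G F MN less.prems)
    have P0: "P \<noteq> 0" using False F(3) by auto
    have degM: "Polynomial.degree (F * ?M) = Polynomial.degree P"
      using P0 F(2,3) False by (subst degree_mult_eq) (auto simp: degree_monom_eq e_def)
    have "Polynomial.degree (P - F * ?M) < Polynomial.degree P"
    proof (rule degree_lessI)
      show "P - F * ?M \<noteq> 0 \<or> 0 < Polynomial.degree P" using False F(3) by auto
      have "Polynomial.lead_coeff (F * ?M) = Polynomial.lead_coeff P"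
        using F(2) by (simp only: lead_coeff_mult Polynomial.lead_coeff_monom mult_1_left)
      then have "Polynomial.coeff (P - F * ?M) (Polynomial.degree P) = 0"
        using degM by simp
      moreover have "Polynomial.coeff (P - F * ?M) k = 0" if "k > Polynomial.degree P" for k
        using that degM by (simp add: coeff_eq_0)
      ultimately show "\<forall>k\<ge>Polynomial.degree P. Polynomial.coeff (P - F * ?M) k = 0"
        using le_neq_implies_less by blast
    qed
    from less.hyps[OF this rel] obtain A B R S where ABRS: "coeffs_rel G A B" "coeffs_rel G R S"
      "P - F * ?M = F * A + R" "Q - F' * ?N = F' * B + S" "Polynomial.degree R < Polynomial.degree F"
      by blast
    have "P = F * (A + ?M) + R" "Q = F' * (B + ?N) + S"
      using ABRS(3,4) by (simp_all add: algebra_simps)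
    then show ?thesis
      using ABRS MN coeffs_rel_add[OF G] by blast
  qed
qed

text \<open>Take a related pair whose first component is nonzero, vanishes at \<open>y\<close> and
  has least degree, and make it monic. Dividing any other pair vanishing at \<open>y\<close> by it
  leaves a remainder that vanishes at \<open>y\<close> in smaller degree, hence 0.\<close>

lemma minimal_pair_exists:
  fixes y :: "'a::field alg_closure"
  assumes G: "partial_hom G"
  obtains F F' where "minimal_pair G y F F'"
proof -
  define ok where "ok = (\<lambda>P. P \<noteq> 0 \<and> poly P y = 0 \<and> (\<exists>Q. coeffs_rel G P Q))"
  obtain p :: "'a poly" where "p \<noteq> 0" "poly (map_poly to_ac p) y = 0"
    using alg_closure_algebraic .
  then have "ok (map_poly to_ac p)"
    unfolding ok_def using coeffs_rel_to_ac[OF G, of p]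
    by (metis (no_types, lifting) map_poly_eq_0_iff to_ac_eq_0_iff to_ac_0)
  then obtain P where P: "ok P" "\<And>P'. ok P' \<Longrightarrow> Polynomial.degree P \<le> Polynomial.degree P'"
    using ex_has_least_nat[of ok _ Polynomial.degree] by blast
  then obtain Q where PQ: "coeffs_rel G P Q" and P0: "P \<noteq> 0" "poly P y = 0"
    unfolding ok_def by blast
  let ?c = "inverse (Polynomial.lead_coeff P)" and ?d = "inverse (Polynomial.coeff Q (Polynomial.degree P))"
  define F where "F = smult ?c P"
  define F' where "F' = smult ?d Q"
  have rel: "coeffs_rel G F F'"
    unfolding F_def F'_def using PQ partial_hom_inverse[OF G]
    by (intro coeffs_rel_smult[OF G]) (auto simp: coeffs_rel_def)
  have lead: "Polynomial.lead_coeff F = 1" and root: "poly F y = 0"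
    and deg: "Polynomial.degree F = Polynomial.degree P"
    using P0 by (simp_all add: F_def)
  have pos: "Polynomial.degree F > 0"
  proof (rule gr0I)
    assume "Polynomial.degree F = 0"
    then obtain c where "F = [:c:]" using degree_eq_zeroE by blast
    then show False using root lead by auto
  qed
  have "\<exists>A B. coeffs_rel G A B \<and> A' = F * A \<and> B' = F' * B"
    if AB: "coeffs_rel G A' B'" "poly A' y = 0" for A' B'
  proof -
    obtain A B R S where *: "coeffs_rel G A B" "coeffs_rel G R S"
      "A' = F * A + R" "B' = F' * B + S" "Polynomial.degree R < Polynomial.degree F"
      using coeffs_rel_division[OF G rel lead pos AB(1)] by blast
    have "poly R y = 0" using *(3) AB(2) root by simp
    then have "R = 0"
      using P(2)[of R] *(2,5) deg unfolding ok_def by (metis not_less)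
    moreover have "S = 0"
      using *(2) \<open>R = 0\<close> partial_hom_zeroD[OF G] by (intro poly_eqI) (auto simp: coeffs_rel_def)
    ultimately show ?thesis using * by auto
  qed
  then have "minimal_pair G y F F'"
    using rel lead root unfolding minimal_pair_def by blast
  then show ?thesis using that by blast
qed

definition hom_extension where
  "hom_extension G y y' = {(poly P y, poly Q y') |P Q. coeffs_rel G P Q}"

text \<open>The usual extension to a simple extension, with \<open>poly P y\<close> going to
  \<open>poly Q y'\<close>. It is well defined because \<open>poly P y = 0\<close> makes
  \<open>Q\<close> a multiple of \<open>F'\<close>, which vanishes at \<open>y'\<close>.\<close>

lemma partial_hom_extension:
  assumes G: "partial_hom G" and F: "minimal_pair G y F F'" and y': "poly F' y' = 0"
  shows "partial_hom (hom_extension G y y')"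
    and "G \<subseteq> hom_extension G y y'"
    and "(y, y') \<in> hom_extension G y y'"
proof -
  show sub: "G \<subseteq> hom_extension G y y'"
  proof
    fix z assume "z \<in> G"
    then obtain a b where "z = (a, b)" "(a, b) \<in> G" by (cases z) auto
    then show "z \<in> hom_extension G y y'"
      unfolding hom_extension_def
      using coeffs_rel_pCons[OF G _ coeffs_rel_0[OF G]]
      by (intro CollectI exI[of _ "[:a:]"] exI[of _ "[:b:]"]) auto
  qed
  show "(y, y') \<in> hom_extension G y y'"
    unfolding hom_extension_def
    using coeffs_rel_monom[OF G partial_hom_1[OF G], of 1]
    by (intro CollectI exI[of _ "Polynomial.monom 1 1"]) (auto simp: poly_monom)
  show "partial_hom (hom_extension G y y')"
    unfolding partial_hom_def
  proof (intro conjI allI impI)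
    fix c show "(to_ac c, to_ac c) \<in> hom_extension G y y'"
      using sub partial_hom_const[OF G] by blast
  next
    fix b assume "(0, b) \<in> hom_extension G y y'"
    then obtain P Q where "coeffs_rel G P Q" "poly P y = 0" "b = poly Q y'"
      unfolding hom_extension_def by auto
    then show "b = 0" using F y' unfolding minimal_pair_def by fastforce
  next
    fix a b a' b' assume "(a, b) \<in> hom_extension G y y'" "(a', b') \<in> hom_extension G y y'"
    then obtain P Q P' Q' where *: "coeffs_rel G P Q" "a = poly P y" "b = poly Q y'"
      "coeffs_rel G P' Q'" "a' = poly P' y" "b' = poly Q' y'"
      unfolding hom_extension_def by auto
    show "(a + a', b + b') \<in> hom_extension G y y'"
      unfolding hom_extension_def using * coeffs_rel_add[OF G]
      by (intro CollectI exI[of _ "P + P'"] exI[of _ "Q + Q'"]) auto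
    show "(a * a', b * b') \<in> hom_extension G y y'"
      unfolding hom_extension_def using * coeffs_rel_mult[OF G]
      by (intro CollectI exI[of _ "P * P'"] exI[of _ "Q * Q'"]) auto
  qed
qed

section \<open>Extension to the whole closure\<close>

definition closure_endo :: "('a::field alg_closure \<Rightarrow> 'a alg_closure) \<Rightarrow> bool" where
  "closure_endo \<sigma> \<longleftrightarrow> (\<forall>c. \<sigma> (to_ac c) = to_ac c) \<and>
     (\<forall>x y. \<sigma> (x + y) = \<sigma> x + \<sigma> y) \<and> (\<forall>x y. \<sigma> (x * y) = \<sigma> x * \<sigma> y)"

text \<open>Zorn's lemma on the graphs containing \<open>G\<close>. A maximal graph has full domain:
  for any \<open>a\<close> the image \<open>F'\<close> of its minimal polynomial has a root
  \<open>b\<close>, and the extension sending \<open>a\<close> to \<open>b\<close> must be the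
  maximal graph itself.\<close>

lemma partial_hom_extends:
  fixes G :: "('a::field alg_closure \<times> 'a alg_closure) set"
  assumes "partial_hom G"
  obtains \<sigma> where "closure_endo \<sigma>" "\<And>a b. (a, b) \<in> G \<Longrightarrow> \<sigma> a = b"
proof -
  define S where "S = {H. partial_hom H \<and> G \<subseteq> H}"
  have "\<exists>M\<in>S. \<forall>H\<in>S. M \<subseteq> H \<longrightarrow> H = M"
  proof (rule subset_Zorn)
    fix C assume C: "subset.chain S C"
    show "\<exists>U\<in>S. \<forall>H\<in>C. H \<subseteq> U"
    proof (cases "C = {}")
      case True
      then show ?thesis using assms by (auto simp: S_def)
    next
      case False
      have hom: "partial_hom H" "G \<subseteq> H" if "H \<in> C" for H
        using C that by (auto simp: subset_chain_def S_def)
      have "partial_hom (\<Union>C)"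
        unfolding partial_hom_def
      proof (intro conjI allI impI)
        fix c show "(to_ac c, to_ac c) \<in> \<Union>C" using False hom partial_hom_const by blast
      next
        fix b assume "(0, b) \<in> \<Union>C"
        then show "b = 0" using hom partial_hom_zeroD by blast
      next
        fix a b a' b' assume "(a, b) \<in> \<Union>C" "(a', b') \<in> \<Union>C"
        then obtain H where H: "H \<in> C" "(a, b) \<in> H" "(a', b') \<in> H"
          using C unfolding subset_chain_def by blast
        show "(a + a', b + b') \<in> \<Union>C" using H partial_hom_add hom by blast
        show "(a * a', b * b') \<in> \<Union>C" using H partial_hom_mult hom by blast
      qed
      then show ?thesis using False hom unfolding S_def by blast
    qed
  qed
  then obtain M where "M \<in> S" and max: "\<forall>H\<in>S. M \<subseteq> H \<longrightarrow> H = M"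
    by (elim bexE)
  then have M: "partial_hom M" "G \<subseteq> M" by (simp_all add: S_def)
  have M_max: "H = M" if "partial_hom H" "M \<subseteq> H" for H
    using max that M(2) by (simp add: S_def)
  have total: "\<exists>b. (a, b) \<in> M" for a
  proof -
    obtain F F' where F: "minimal_pair M a F F'" using minimal_pair_exists[OF M(1)] .
    have "Polynomial.degree F' = Polynomial.degree F"
      using F coeffs_rel_degree[OF M(1)] unfolding minimal_pair_def by metis
    moreover have "Polynomial.degree F \<noteq> 0"
    proof
      assume "Polynomial.degree F = 0"
      then obtain c where "F = [:c:]" using degree_eq_zeroE by blast
      then show False using F unfolding minimal_pair_def by auto
    qed
    ultimately obtain b where "poly F' b = 0"
      using alg_closed_imp_poly_has_root[of F'] by auto
    then have "(a, b) \<in> hom_extension M a b" "hom_extension M a b = M"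
      using partial_hom_extension[OF M(1) F] M_max[of "hom_extension M a b"] by auto
    then show ?thesis by auto
  qed
  define \<sigma> where "\<sigma> = (\<lambda>a. SOME b. (a, b) \<in> M)"
  have \<sigma>: "(a, \<sigma> a) \<in> M" for a unfolding \<sigma>_def using total someI_ex by metis
  have eq: "\<sigma> a = b" if "(a, b) \<in> M" for a b
    using partial_hom_unique[OF M(1) \<sigma> that] .
  have "closure_endo \<sigma>"
    unfolding closure_endo_def
    using eq[OF partial_hom_const[OF M(1)]] eq[OF partial_hom_add[OF M(1) \<sigma> \<sigma>]]
      eq[OF partial_hom_mult[OF M(1) \<sigma> \<sigma>]] by blast
  then show ?thesis using that eq M(2) by blast
qed

section \<open>Automorphisms and the maximal abelian extension\<close>

abbreviation poly_over :: "'a::field alg_closure set \<Rightarrow> 'a alg_closure poly \<Rightarrow> bool" where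
  "poly_over K P \<equiv> coeffs_rel (Id_on K) P P"

lemma coeffs_rel_Id_on: "coeffs_rel (Id_on K) P Q \<longleftrightarrow> P = Q \<and> (\<forall>i. Polynomial.coeff P i \<in> K)"
  by (auto simp: coeffs_rel_def Id_on_def poly_eq_iff)

lemma poly_overD: "poly_over K P \<Longrightarrow> Polynomial.coeff P i \<in> K"
  by (simp add: coeffs_rel_Id_on)

lemma uminus_ring_of_type_algebra: "\<ominus>\<^bsub>ring_of_type_algebra\<^esub> x = - (x :: 'a::field)"
proof -
  interpret field "ring_of_type_algebra :: 'a ring" by (rule field_from_type_algebra)
  show ?thesis
    using minus_equality[of "- x" x] by (simp add: ring_of_type_algebra_def)
qed

lemma inverse_ring_of_type_algebra: "x \<noteq> 0 \<Longrightarrow> inv\<^bsub>ring_of_type_algebra\<^esub> x = inverse (x :: 'a::field)"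
proof -
  assume "x \<noteq> 0"
  interpret field "ring_of_type_algebra :: 'a ring" by (rule field_from_type_algebra)
  show ?thesis
    using comm_inv_char[of x "inverse x"] \<open>x \<noteq> 0\<close> by (simp add: ring_of_type_algebra_def)
qed

lemma ring_of_type_algebra_simps [simp]:
  "carrier ring_of_type_algebra = UNIV"
  "x \<otimes>\<^bsub>ring_of_type_algebra\<^esub> y = x * (y :: 'a::field)"
  "x \<oplus>\<^bsub>ring_of_type_algebra\<^esub> y = x + y"
  "\<one>\<^bsub>ring_of_type_algebra\<^esub> = (1 :: 'a)"
  "\<zero>\<^bsub>ring_of_type_algebra\<^esub> = (0 :: 'a)"
  by (simp_all add: ring_of_type_algebra_def)

text \<open>Closure under sums and products is enough for a field here: inverses come from
  algebraicity through \<open>partial_hom_inverse\<close>, negatives from multiplication by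
  -1.\<close>

lemma intermediate_field_iff_partial_hom:
  "intermediate_field L \<longleftrightarrow> partial_hom (Id_on (L :: 'a::field alg_closure set))"
proof -
  interpret field "ring_of_type_algebra :: 'a alg_closure ring" by (rule field_from_type_algebra)
  show ?thesis
  proof
    assume "intermediate_field L"
    then have L: "subring L ring_of_type_algebra" "range to_ac \<subseteq> L"
      by (auto simp: intermediate_field_def subfieldE)
    then show "partial_hom (Id_on L)"
      using subringE(6,7)[OF L(1)] by (auto simp: partial_hom_def Id_on_def)
  next
    assume *: "partial_hom (Id_on L)"
    have "subfield L ring_of_type_algebra"
    proof (intro subfieldI' subringI)
      fix x assume "x \<in> L - {\<zero>\<^bsub>ring_of_type_algebra\<^esub>}"
      then show "inv\<^bsub>ring_of_type_algebra\<^esub> x \<in> L"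
        using partial_hom_inverse[OF *, of x x] by (auto simp: inverse_ring_of_type_algebra)
    next
      fix x assume "x \<in> L"
      then show "\<ominus>\<^bsub>ring_of_type_algebra\<^esub> x \<in> L"
        using partial_hom_uminus[OF *, of x x] by (auto simp: uminus_ring_of_type_algebra)
    next
      fix x y assume "x \<in> L" "y \<in> L"
      then have "(x, x) \<in> Id_on L" "(y, y) \<in> Id_on L" by auto
      then show "x \<otimes>\<^bsub>ring_of_type_algebra\<^esub> y \<in> L" "x \<oplus>\<^bsub>ring_of_type_algebra\<^esub> y \<in> L"
        using partial_hom_add[OF *] partial_hom_mult[OF *] by fastforce+
    qed (use partial_hom_1[OF *] in auto)
    then show "intermediate_field L"
      using partial_hom_const[OF *] by (auto simp: intermediate_field_def)
  qed
qed

lemma intermediate_fieldD: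
  assumes "intermediate_field L"
  shows "to_ac c \<in> L" "x \<in> L \<Longrightarrow> y \<in> L \<Longrightarrow> x + y \<in> L" "x \<in> L \<Longrightarrow> y \<in> L \<Longrightarrow> x * y \<in> L"
    "x \<in> L \<Longrightarrow> - x \<in> L" "x \<in> L \<Longrightarrow> inverse x \<in> L" "0 \<in> L" "1 \<in> L"
    "x \<in> L \<Longrightarrow> x ^ n \<in> L" "x \<in> L \<Longrightarrow> y \<in> L \<Longrightarrow> x / y \<in> L"
proof -
  have L: "partial_hom (Id_on L)" using assms by (simp add: intermediate_field_iff_partial_hom)
  show "to_ac c \<in> L" using partial_hom_const[OF L, of c] by auto
  show "x \<in> L \<Longrightarrow> y \<in> L \<Longrightarrow> x + y \<in> L" using partial_hom_add[OF L, of x x y y] by auto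
  show mult: "x \<in> L \<Longrightarrow> y \<in> L \<Longrightarrow> x * y \<in> L" for x y using partial_hom_mult[OF L, of x x y y] by auto
  show "x \<in> L \<Longrightarrow> - x \<in> L" using partial_hom_uminus[OF L, of x x] by auto
  show inv: "x \<in> L \<Longrightarrow> inverse x \<in> L" for x using partial_hom_inverse[OF L, of x x] by auto
  show "0 \<in> L" using partial_hom_0[OF L] by auto
  show one: "1 \<in> L" using partial_hom_1[OF L] by auto
  show "x \<in> L \<Longrightarrow> x ^ n \<in> L" by (induction n) (use one mult in auto)
  show "x \<in> L \<Longrightarrow> y \<in> L \<Longrightarrow> x / y \<in> L" using mult inv by (simp add: divide_inverse)
qed

lemma intermediate_field_Int:
  assumes "intermediate_field K" "intermediate_field L"
  shows "intermediate_field (K \<inter> L)"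
  using intermediate_fieldD(1-3)[OF assms(1)] intermediate_fieldD(1-3)[OF assms(2)]
  by (simp add: intermediate_field_iff_partial_hom partial_hom_def Id_on_iff)

lemma intermediate_field_base: "intermediate_field (range (to_ac :: 'a::field \<Rightarrow> _))"
  unfolding intermediate_field_iff_partial_hom partial_hom_def
  by (auto simp: Id_on_def image_iff simp flip: to_ac_add to_ac_mult)

lemma minimal_polynomial_exists:
  assumes "intermediate_field K"
  obtains F where "minimal_pair (Id_on K) y F F"
proof -
  obtain F F' where "minimal_pair (Id_on K) y F F'"
    using minimal_pair_exists assms intermediate_field_iff_partial_hom by blast
  moreover from this have "F' = F" unfolding minimal_pair_def coeffs_rel_Id_on by blast
  ultimately show ?thesis using that by blast
qed

lemma minimal_polynomialD:
  assumes "minimal_pair (Id_on K) y F F"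
  shows "poly_over K F" "Polynomial.lead_coeff F = 1" "poly F y = 0"
    "poly_over K P \<Longrightarrow> poly P y = 0 \<Longrightarrow> F dvd P"
    "Polynomial.degree F > 0"
proof -
  show "poly_over K F" and 1: "Polynomial.lead_coeff F = 1" "poly F y = 0"
    using assms by (auto simp: minimal_pair_def)
  show "F dvd P" if "poly_over K P" "poly P y = 0"
    using assms that unfolding minimal_pair_def by (metis dvd_triv_left)
  show "Polynomial.degree F > 0"
  proof (rule gr0I)
    assume "Polynomial.degree F = 0"
    then obtain c where "F = [:c:]" using degree_eq_zeroE by blast
    then show False using 1 by auto
  qed
qed

text \<open>By algebraicity the values at \<open>t\<close> of polynomials over \<open>k\<close>
  already form a field.\<close>

lemma adjoin_eq: "adjoin t = {poly P t |P. poly_over (range to_ac) P}" (is "_ = ?A")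
proof -
  interpret field "ring_of_type_algebra :: 'a alg_closure ring" by (rule field_from_type_algebra)
  have base: "partial_hom (Id_on (range (to_ac :: 'a \<Rightarrow> _)))"
    using intermediate_field_base by (simp add: intermediate_field_iff_partial_hom)
  obtain F where F: "minimal_pair (Id_on (range to_ac)) t F F"
    using minimal_polynomial_exists[OF intermediate_field_base] .
  \<comment> \<open>This set is the domain of the extension of the identity of \<open>k\<close> that
    sends \<open>t\<close> to \<open>t\<close>, so \<open>partial_hom_extension\<close> shows that
    it is a field.\<close>
  have *: "hom_extension (Id_on (range to_ac)) t t = Id_on ?A"
    by (auto simp: hom_extension_def coeffs_rel_Id_on)
  have A: "intermediate_field ?A" and "t \<in> ?A"
    using partial_hom_extension[OF base F minimal_polynomialD(3)[OF F]]
    unfolding * intermediate_field_iff_partial_hom by auto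
  show ?thesis unfolding adjoin_def
  proof (rule sym, rule generate_fieldI)
    show "subfield ?A ring_of_type_algebra" "insert t (range to_ac) \<subseteq> ?A"
      using A \<open>t \<in> ?A\<close> unfolding intermediate_field_def by auto
    show "?A \<subseteq> K" if "subfield K ring_of_type_algebra" "insert t (range to_ac) \<subseteq> K" for K
    proof
      fix x assume "x \<in> ?A"
      then obtain P where "x = poly P t" "poly_over (range to_ac) P" by auto
      moreover have K: "intermediate_field K" using that by (simp add: intermediate_field_def)
      ultimately have "poly_over K P" using that(2) by (auto simp: coeffs_rel_Id_on)
      then have "(poly P t, poly P t) \<in> Id_on K"
        using coeffs_rel_poly[of "Id_on K" P P t t] that K
        by (auto simp: intermediate_field_iff_partial_hom)
      then show "x \<in> K" using \<open>x = poly P t\<close> by auto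
    qed
  qed auto
qed

lemma intermediate_field_generate:
  fixes H :: "'a::field alg_closure set"
  assumes "range to_ac \<subseteq> H"
  shows "intermediate_field (generate_field ring_of_type_algebra H)"
proof -
  interpret field "ring_of_type_algebra :: 'a alg_closure ring" by (rule field_from_type_algebra)
  show ?thesis
    using generate_field_is_subfield[of H] assms generate_field.incl[of _ H]
    by (auto simp: intermediate_field_def)
qed

lemma generate_field_least:
  fixes H :: "'a::field alg_closure set"
  assumes "intermediate_field K" "H \<subseteq> K"
  shows "generate_field ring_of_type_algebra H \<subseteq> K"
proof -
  interpret field "ring_of_type_algebra :: 'a alg_closure ring" by (rule field_from_type_algebra)
  show ?thesis
    using generate_field_min_subfield1 assms by (simp add: intermediate_field_def)
qed

lemma intermediate_field_adjoin: "intermediate_field (adjoin t)"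
  unfolding adjoin_def by (rule intermediate_field_generate) auto

lemma adjoin_self: "t \<in> adjoin t"
  unfolding adjoin_def by (rule generate_field.incl) auto

lemma adjoin_least: "intermediate_field K \<Longrightarrow> t \<in> K \<Longrightarrow> adjoin t \<subseteq> K"
  unfolding adjoin_def by (rule generate_field_least) (auto simp: intermediate_field_def)

lemma poly_in_field:
  assumes "intermediate_field K" "poly_over K P" "x \<in> K"
  shows "poly P x \<in> K"
  using coeffs_rel_poly[of "Id_on K" P P x x] assms by (auto simp: intermediate_field_iff_partial_hom)

section \<open>Endomorphisms of the closure and automorphisms of intermediate fields\<close>

lemma closure_endo_partial_hom:
  assumes "closure_endo \<sigma>"
  shows "partial_hom (range (\<lambda>x. (x, \<sigma> x)))"
proof -
  have "\<sigma> 0 = 0" using assms unfolding closure_endo_def by (metis to_ac_0)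
  then show ?thesis
    using assms by (auto simp: partial_hom_def closure_endo_def image_iff)
qed

lemma closure_endo_simps:
  assumes "closure_endo \<sigma>"
  shows "\<sigma> (to_ac c) = to_ac c" "\<sigma> (x + y) = \<sigma> x + \<sigma> y" "\<sigma> (x * y) = \<sigma> x * \<sigma> y"
    "\<sigma> (x ^ n) = \<sigma> x ^ n" "\<sigma> (inverse x) = inverse (\<sigma> x)" "\<sigma> (x / y) = \<sigma> x / \<sigma> y"
    "\<sigma> x = \<sigma> y \<longleftrightarrow> x = y"
proof -
  note hom = closure_endo_partial_hom[OF assms]
  show mult: "\<sigma> (to_ac c) = to_ac c" "\<sigma> (x + y) = \<sigma> x + \<sigma> y" "\<sigma> (x * y) = \<sigma> x * \<sigma> y" for x y
    using assms by (auto simp: closure_endo_def)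
  have "\<sigma> 1 = 1" using assms by (metis closure_endo_def to_ac_1)
  then show "\<sigma> (x ^ n) = \<sigma> x ^ n" by (induction n) (auto simp: mult)
  show inv: "\<sigma> (inverse x) = inverse (\<sigma> x)" for x
    using partial_hom_inverse[OF hom, of x "\<sigma> x"] by auto
  then show "\<sigma> (x / y) = \<sigma> x / \<sigma> y" by (simp add: divide_inverse mult)
  have "(x - y, \<sigma> x - \<sigma> y) \<in> range (\<lambda>x. (x, \<sigma> x))"
    by (intro partial_hom_diff[OF hom]) auto
  from partial_hom_eq_0_iff[OF hom this] show "\<sigma> x = \<sigma> y \<longleftrightarrow> x = y" by auto
qed

lemma closure_endo_poly:
  assumes "closure_endo \<sigma>" "poly_over (range to_ac) P"
  shows "\<sigma> (poly P x) = poly P (\<sigma> x)"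
proof -
  have "coeffs_rel (range (\<lambda>x. (x, \<sigma> x))) P P"
    unfolding coeffs_rel_def
  proof
    fix i
    obtain c where "Polynomial.coeff P i = to_ac c" using poly_overD[OF assms(2), of i] by auto
    then show "(Polynomial.coeff P i, Polynomial.coeff P i) \<in> range (\<lambda>x. (x, \<sigma> x))"
      using closure_endo_simps(1)[OF assms(1)] by (metis rangeI)
  qed
  then show ?thesis
    using coeffs_rel_poly[OF closure_endo_partial_hom[OF assms(1)], of P P x "\<sigma> x"] by auto
qed

lemma automorphism_partial_hom:
  assumes "intermediate_field L" "\<tau> \<in> automorphisms_over L"
  shows "partial_hom ((\<lambda>x. (x, \<tau> x)) ` L)"
proof -
  have hom: "\<tau> (x + y) = \<tau> x + \<tau> y" "\<tau> (x * y) = \<tau> x * \<tau> y" if "x \<in> L" "y \<in> L" for x y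
    using assms(2) that by (auto simp: automorphisms_over_def ring_iso_def ring_hom_def)
  have const: "\<tau> (to_ac c) = to_ac c" for c
    using assms(2) by (auto simp: automorphisms_over_def)
  have "\<tau> 0 = 0" using const[of 0] by simp
  then show ?thesis
    using intermediate_fieldD[OF assms(1)] const by (auto simp: partial_hom_def image_iff hom)
qed

lemma automorphism_closed: "\<tau> \<in> automorphisms_over L \<Longrightarrow> x \<in> L \<Longrightarrow> \<tau> x \<in> L"
  by (auto simp: automorphisms_over_def ring_iso_def ring_hom_def)

lemma automorphism_inj_on: "\<tau> \<in> automorphisms_over L \<Longrightarrow> inj_on \<tau> L"
  by (auto simp: automorphisms_over_def ring_iso_def bij_betw_def)

lemma automorphism_comp:
  "\<sigma> \<in> automorphisms_over L \<Longrightarrow> \<tau> \<in> automorphisms_over L \<Longrightarrow> \<tau> \<circ> \<sigma> \<in> automorphisms_over L"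
  unfolding automorphisms_over_def using ring_iso_set_trans by fastforce

lemma automorphism_poly:
  assumes L: "intermediate_field L" "\<tau> \<in> automorphisms_over L"
    and "poly_over (range to_ac) P" "x \<in> L"
  shows "\<tau> (poly P x) = poly P (\<tau> x)"
proof -
  have "coeffs_rel ((\<lambda>x. (x, \<tau> x)) ` L) P P"
    unfolding coeffs_rel_def
  proof
    fix i
    obtain c where "Polynomial.coeff P i = to_ac c" using poly_overD[OF assms(3), of i] by auto
    then show "(Polynomial.coeff P i, Polynomial.coeff P i) \<in> (\<lambda>x. (x, \<tau> x)) ` L"
      using partial_hom_const[OF automorphism_partial_hom[OF L]] by simp
  qed
  then show ?thesis
    using coeffs_rel_poly[OF automorphism_partial_hom[OF L], of P P x "\<tau> x"] assms(4) by auto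
qed

text \<open>The identity of \<open>k\<close> extends to a homomorphism taking \<open>y\<close> to
  \<open>y'\<close>, and from there to the whole closure.\<close>

lemma conjugate_endo:
  assumes "minimal_pair (Id_on (range to_ac)) y F F" "poly F y' = 0"
  obtains \<sigma> where "closure_endo \<sigma>" "\<sigma> y = y'"
proof -
  have base: "partial_hom (Id_on (range (to_ac :: 'a \<Rightarrow> _)))"
    using intermediate_field_base by (simp add: intermediate_field_iff_partial_hom)
  show ?thesis
    using partial_hom_extends[OF partial_hom_extension(1)[OF base assms]]
      partial_hom_extension(3)[OF base assms] that by metis
qed

lemma algebraic_over_base:
  obtains P where "P \<noteq> 0" "poly_over (range to_ac) P" "poly P x = 0"
proof -
  obtain F where F: "minimal_pair (Id_on (range to_ac)) x F F"
    using minimal_polynomial_exists[OF intermediate_field_base] .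
  show ?thesis
    using that[of F] minimal_polynomialD[OF F] by force
qed

text \<open>Surjectivity on \<open>L\<close> is the point: \<open>x\<close> is a root of some
  polynomial over \<open>k\<close>, and the injective map \<open>\<sigma>\<close> permutes the
  finitely many roots of this polynomial in \<open>L\<close>.\<close>

lemma closure_endo_restrict:
  assumes \<sigma>: "closure_endo \<sigma>" and L: "intermediate_field L" and stable: "\<And>x. x \<in> L \<Longrightarrow> \<sigma> x \<in> L"
  shows "\<sigma> \<in> automorphisms_over L"
proof -
  have inj: "inj_on \<sigma> A" for A using closure_endo_simps(7)[OF \<sigma>] by (auto simp: inj_on_def)
  have "\<sigma> ` L = L"
  proof
    show "L \<subseteq> \<sigma> ` L"
    proof
      fix x assume "x \<in> L"
      obtain P where P: "P \<noteq> 0" "poly_over (range to_ac) P" "poly P x = 0"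
        using algebraic_over_base .
      let ?R = "{y \<in> L. poly P y = 0}"
      have "\<sigma> ` ?R \<subseteq> ?R"
      proof safe
        fix y assume "y \<in> L" "poly P y = 0"
        then show "poly P (\<sigma> y) = 0"
          using closure_endo_poly[OF \<sigma> P(2), of y] closure_endo_simps(1)[OF \<sigma>, of 0] by simp
      qed (use stable in auto)
      then have "\<sigma> ` ?R = ?R"
        using poly_roots_finite[OF P(1)] by (intro endo_inj_surj inj) auto
      then show "x \<in> \<sigma> ` L" using P(3) \<open>x \<in> L\<close> by blast
    qed
  qed (use stable in auto)
  moreover have "\<sigma> 1 = 1" using closure_endo_simps(1)[OF \<sigma>, of 1] by simp
  ultimately show ?thesis
    using stable closure_endo_simps[OF \<sigma>] inj[of L]
    by (auto simp: automorphisms_over_def ring_iso_def ring_hom_def bij_betw_def)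
qed

text \<open>The orbit of \<open>x\<close> under the automorphisms of \<open>L\<close> is finite, and the monic polynomial with
  this orbit as its set of roots has coefficients in the fixed field \<open>k\<close>.\<close>

lemma galois_extension_stable:
  assumes gal: "galois_extension L" and \<sigma>: "closure_endo \<sigma>" and x: "x \<in> L"
  shows "\<sigma> x \<in> L"
proof -
  have L: "intermediate_field L" using gal by (simp add: galois_extension_def)
  note hom = automorphism_partial_hom[OF L]
  obtain P where P: "P \<noteq> 0" "poly_over (range to_ac) P" "poly P x = 0"
    using algebraic_over_base .
  define B where "B = (\<lambda>\<tau>. \<tau> x) ` automorphisms_over L"
  have BL: "B \<subseteq> L" using automorphism_closed x by (auto simp: B_def)
  have "\<tau> 0 = 0" if "\<tau> \<in> automorphisms_over L" for \<tau>
    using that by (metis (mono_tags, lifting) automorphisms_over_def mem_Collect_eq to_ac_0)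
  then have "B \<subseteq> {y. poly P y = 0}"
    using automorphism_poly[OF L _ P(2) x] P(3) by (force simp: B_def)
  then have fin: "finite B" using poly_roots_finite[OF P(1)] finite_subset by blast
  have id: "id \<in> automorphisms_over L"
    using ring_iso_set_refl by (auto simp: automorphisms_over_def)
  then have xB: "x \<in> B" unfolding B_def using image_eqI[of x "\<lambda>\<tau>. \<tau> x" id] by simp
  define F where "F = (\<Prod>y\<in>B. [:- y, 1:])"
  have perm: "coeffs_rel ((\<lambda>x. (x, \<tau> x)) ` L) F F" if \<tau>: "\<tau> \<in> automorphisms_over L" for \<tau>
  proof -
    have "\<tau> ` B \<subseteq> B" 
    proof
      fix z assume "z \<in> \<tau> ` B"
      then obtain \<rho> where "\<rho> \<in> automorphisms_over L" "z = (\<tau> \<circ> \<rho>) x" by (auto simp: B_def)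
      then show "z \<in> B" unfolding B_def using automorphism_comp[OF _ \<tau>] by blast
    qed
    then have B: "\<tau> ` B = B"
      using fin BL by (intro endo_inj_surj inj_on_subset[OF automorphism_inj_on[OF \<tau>]]) auto
    have "coeffs_rel ((\<lambda>x. (x, \<tau> x)) ` L) (\<Prod>y\<in>B. [:- y, 1:]) (\<Prod>y\<in>B. [:- \<tau> y, 1:])"
      using BL hom[OF \<tau>]
      by (intro coeffs_rel_prod coeffs_rel_pCons coeffs_rel_0 partial_hom_uminus partial_hom_1) auto
    also have "(\<Prod>y\<in>B. [:- \<tau> y, 1:]) = F"
      using prod.reindex[OF inj_on_subset[OF automorphism_inj_on[OF \<tau>] BL], of "\<lambda>y. [:- y, 1:]"]
      by (simp add: B F_def)
    finally show ?thesis by (simp add: F_def)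
  qed
  have "Polynomial.coeff F i \<in> range to_ac" for i
  proof -
    have "Polynomial.coeff F i \<in> L" using perm[OF id] by (auto simp: coeffs_rel_def)
    moreover have "\<tau> (Polynomial.coeff F i) = Polynomial.coeff F i"
      if "\<tau> \<in> automorphisms_over L" for \<tau>
      using perm[OF that] by (auto simp: coeffs_rel_def image_iff)
    ultimately show ?thesis using gal unfolding galois_extension_def by blast
  qed
  then have "poly_over (range to_ac) F" by (simp add: coeffs_rel_Id_on)
  moreover have "poly F x = 0" using xB fin by (simp add: F_def poly_prod)
  \<comment> \<open>Now \<open>F\<close> has coefficients in \<open>k\<close>, so
    \<open>\<sigma>\<close> maps its root \<open>x\<close> to another root, that is, to a member of
    the orbit.\<close>
  ultimately have "poly F (\<sigma> x) = 0"
    using closure_endo_poly[OF \<sigma>, of F x] closure_endo_simps(1)[OF \<sigma>, of 0] by simp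
  then have "\<sigma> x \<in> B" using fin by (auto simp: F_def poly_prod)
  then show ?thesis using BL by blast
qed

text \<open>The elements at which \<open>\<sigma>\<close> and \<open>\<tau>\<close> commute form an
  intermediate field. It contains every abelian extension \<open>L\<close>, because both maps
  restrict to automorphisms of \<open>L\<close> by \<open>galois_extension_stable\<close>.\<close>

lemma closure_endos_commute:
  fixes x :: "'a::field alg_closure"
  assumes \<sigma>: "closure_endo \<sigma>" and \<tau>: "closure_endo \<tau>" and x: "x \<in> maximal_abelian_extension"
  shows "\<sigma> (\<tau> x) = \<tau> (\<sigma> x)"
proof -
  let ?C = "{x. \<sigma> (\<tau> x) = \<tau> (\<sigma> x)}"
  have "intermediate_field ?C"
    unfolding intermediate_field_iff_partial_hom partial_hom_def
    by (auto simp: closure_endo_simps[OF \<sigma>] closure_endo_simps[OF \<tau>] Id_on_def)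
  moreover have "\<Union>{L. abelian_extension L} \<subseteq> ?C"
  proof safe
    fix L and y :: "'a alg_closure" assume L: "abelian_extension L" and y: "y \<in> L"
    then have gal: "galois_extension L" by (simp add: abelian_extension_def)
    have "\<sigma> \<in> automorphisms_over L" "\<tau> \<in> automorphisms_over L"
      using closure_endo_restrict galois_extension_stable[OF gal] \<sigma> \<tau> gal
      by (auto simp: galois_extension_def)
    then show "\<sigma> (\<tau> y) = \<tau> (\<sigma> y)" using L y by (auto simp: abelian_extension_def)
  qed
  ultimately show ?thesis
    using generate_field_least x unfolding maximal_abelian_extension_def by blast
qed

section \<open>Radical extensions\<close>

text \<open>A double root \<open>y\<close> would be a zero of the derivative, so
  \<open>y ^ (n - 1) = 0\<close>, while \<open>y ^ n = c\<close> is nonzero. This is the source of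
  separability.\<close>

lemma binomial_not_square_dvd:
  fixes c y :: "'a::field"
  assumes n: "of_nat n \<noteq> (0::'a)" and c: "c \<noteq> 0"
  shows "\<not> [:- y, 1:] ^ 2 dvd Polynomial.monom 1 n - [:c:]"
proof
  assume "[:- y, 1:] ^ 2 dvd Polynomial.monom 1 n - [:c:]"
  then obtain A where A: "Polynomial.monom 1 n - [:c:] = [:- y, 1:] * [:- y, 1:] * A"
    unfolding power2_eq_square by (elim dvdE)
  have "poly (Polynomial.monom 1 n - [:c:]) y = 0" unfolding A by simp
  then have yn: "y ^ n = c" by (simp add: poly_monom)
  have "poly (Polynomial.pderiv (Polynomial.monom 1 n - [:c:])) y = 0"
    unfolding A Polynomial.pderiv_mult poly_add poly_mult by simp
  then have "of_nat n * y ^ (n - 1) = 0"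
    by (simp add: Polynomial.pderiv_diff Polynomial.pderiv_monom poly_monom Polynomial.pderiv_pCons)
  then have "y ^ (n - 1) = 0" using n by simp
  moreover have "n > 0" using n by (metis gr0I of_nat_0)
  ultimately have "y ^ n = 0" by (simp add: zero_power)
  then show False using yn c by simp
qed

lemma monic_linear_factor:
  fixes F :: "'a::alg_closed_field poly"
  assumes "Polynomial.lead_coeff F = 1" "Polynomial.degree F = Suc r"
  obtains y H where "F = [:- y, 1:] * H" "Polynomial.lead_coeff H = 1" "Polynomial.degree H = r"
proof -
  obtain y where "poly F y = 0" using alg_closed_imp_poly_has_root[of F] assms(2) by auto
  then obtain H where H: "F = [:- y, 1:] * H" by (metis dvdE poly_eq_0_iff_dvd)
  then have "H \<noteq> 0" using assms(2) by auto
  then have "Polynomial.degree F = 1 + Polynomial.degree H"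
    unfolding H by (subst degree_mult_eq) auto
  moreover have "Polynomial.lead_coeff F = Polynomial.lead_coeff H"
    unfolding H by (subst lead_coeff_mult) simp
  ultimately show ?thesis using that[OF H] assms by (metis Suc_eq_plus1_left diff_Suc_1)
qed

text \<open>Every root of \<open>F\<close> is \<open>t\<close> times an \<open>n\<close>-th root of
  unity, so the product of the roots has the same shape up to a power of \<open>t\<close>. The roots
  are split off one at a time.\<close>

lemma binomial_divisor_const_coeff:
  fixes F :: "'a::alg_closed_field poly"
  assumes "Polynomial.lead_coeff F = 1" "F dvd Polynomial.monom 1 n - [:t ^ n:]" "t \<noteq> 0"
  shows "\<exists>z. z ^ n = 1 \<and>
    Polynomial.coeff F 0 = (-1) ^ Polynomial.degree F * z * t ^ Polynomial.degree F"
  using assms(1,2)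
proof (induction "Polynomial.degree F" arbitrary: F)
  case 0
  then have "Polynomial.coeff F 0 = 1" by simp
  then show ?case using 0(1) by (intro exI[of _ 1]) simp
next
  case (Suc r)
  obtain y H where H: "F = [:- y, 1:] * H" "Polynomial.lead_coeff H = 1" "Polynomial.degree H = r"
    using monic_linear_factor Suc(2,3) by metis
  have dvd: "H dvd Polynomial.monom 1 n - [:t ^ n:]" "[:- y, 1:] dvd Polynomial.monom 1 n - [:t ^ n:]"
    using Suc.prems(2) H(1) dvd_mult_left dvd_mult_right by blast+
  then have y: "poly (Polynomial.monom 1 n - [:t ^ n:]) y = 0"
    unfolding poly_eq_0_iff_dvd by blast
  have "\<exists>z. z ^ n = 1 \<and> Polynomial.coeff H 0 = (-1) ^ r * z * t ^ r"
    using Suc.hyps(1)[of H] H(2,3) dvd by simp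
  then obtain z where z: "z ^ n = 1" "Polynomial.coeff H 0 = (-1) ^ r * z * t ^ r" by blast
  \<comment> \<open>The new root \<open>y\<close> contributes the factor \<open>y / t\<close> to the
    root of unity.\<close>
  with y have "(y / t * z) ^ n = 1"
    using assms(3) by (simp add: poly_monom field_simps)
  moreover have "Polynomial.coeff F 0 = (-1) ^ Suc r * (y / t * z) * t ^ Suc r"
    using z(2) assms(3) by (simp add: H(1) coeff_mult)
  ultimately show ?case using Suc(2) by metis
qed

text \<open>All roots are simple: a root shared by a linear factor and its cofactor would give a
  square dividing the binomial.\<close>

lemma binomial_divisor_card_roots:
  fixes F :: "'a::alg_closed_field poly"
  assumes "Polynomial.lead_coeff F = 1" "F dvd Polynomial.monom 1 n - [:c:]" "c \<noteq> 0" "of_nat n \<noteq> (0::'a)"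
  shows "card {x. poly F x = 0} = Polynomial.degree F"
  using assms(1,2)
proof (induction "Polynomial.degree F" arbitrary: F)
  case 0
  then obtain a where "F = [:a:]" using degree_eq_zeroE by metis
  then show ?case using 0 by simp
next
  case (Suc r)
  obtain y H where H: "F = [:- y, 1:] * H" "Polynomial.lead_coeff H = 1" "Polynomial.degree H = r"
    using monic_linear_factor Suc(2,3) by metis
  have "H dvd Polynomial.monom 1 n - [:c:]"
    using Suc.prems(2) H(1) dvd_mult_right by blast
  then have card: "card {x. poly H x = 0} = r" using Suc.hyps(1)[of H] H(2,3) by auto
  have "poly H y \<noteq> 0"
  proof
    assume "poly H y = 0"
    then have "[:- y, 1:] ^ 2 dvd F"
      unfolding H(1) power2_eq_square poly_eq_0_iff_dvd by (rule mult_dvd_mono[OF dvd_refl])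
    then show False
      using binomial_not_square_dvd[OF assms(4,3)] Suc.prems(2) dvd_trans by blast
  qed
  moreover have "{x. poly F x = 0} = insert y {x. poly H x = 0}" by (auto simp: H(1))
  moreover have "finite {x. poly H x = 0}" using H(2) by (intro poly_roots_finite) auto
  ultimately show ?case using card Suc(2) by simp
qed

lemma degree_binomial: "n > 0 \<Longrightarrow> Polynomial.degree (Polynomial.monom 1 n - [:c:]) = n"
  and lead_coeff_binomial: "n > 0 \<Longrightarrow> Polynomial.lead_coeff (Polynomial.monom 1 n - [:c :: 'a::field:]) = 1"
proof -
  assume n: "n > 0"
  show deg: "Polynomial.degree (Polynomial.monom 1 n - [:c:]) = n"
    using n by (intro antisym degree_le le_degree) (auto simp: coeff_pCons split: nat.split)
  show "Polynomial.lead_coeff (Polynomial.monom 1 n - [:c:]) = 1"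
    unfolding deg using n by (auto simp: coeff_pCons split: nat.split)
qed

section \<open>Radicals and their conjugates\<close>

lemma poly_over_binomial:
  assumes "intermediate_field K" "c \<in> K"
  shows "poly_over K (Polynomial.monom 1 n - [:c:])"
proof -
  have K: "partial_hom (Id_on K)" using assms by (simp add: intermediate_field_iff_partial_hom)
  show ?thesis
    using assms partial_hom_1[OF K]
    by (intro coeffs_rel_diff[OF K] coeffs_rel_monom[OF K] coeffs_rel_pCons[OF K] coeffs_rel_0[OF K]) auto
qed

lemma minimal_polynomial_dvd_binomial:
  assumes "minimal_pair (Id_on K) w F F" "intermediate_field K" "w ^ n \<in> K"
  shows "F dvd Polynomial.monom 1 n - [:w ^ n:]"
  using minimal_polynomialD(4)[OF assms(1) poly_over_binomial[OF assms(2,3)]] by (simp add: poly_monom)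

lemma minimal_polynomial_card_roots:
  fixes c :: "'a::field"
  assumes "minimal_pair (Id_on (range to_ac)) w F F" "w ^ n = to_ac c" "c \<noteq> 0" "of_nat n \<noteq> (0::'a)"
  shows "card {x. poly F x = 0} = Polynomial.degree F"
proof (rule binomial_divisor_card_roots)
  show "F dvd Polynomial.monom 1 n - [:to_ac c:]"
    using minimal_polynomial_dvd_binomial[OF assms(1) intermediate_field_base, of n] assms(2) by simp
  show "of_nat n \<noteq> (0 :: 'a alg_closure)"
    using assms(4) by (metis to_ac_eq_0_iff to_ac_of_nat)
qed (use assms minimal_polynomialD(2)[OF assms(1)] in auto)

text \<open>The conjugates of \<open>w\<close> are its images under endomorphisms, so the minimal
  polynomial has \<open>w\<close> as its only root, and separability makes it linear.\<close>

lemma fixed_radical_in_base: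
  fixes c :: "'a::field"
  assumes w: "w ^ n = to_ac c" "c \<noteq> 0" "of_nat n \<noteq> (0::'a)"
    and fixed: "\<And>\<sigma>. closure_endo \<sigma> \<Longrightarrow> \<sigma> w = w"
  shows "w \<in> range to_ac"
proof -
  obtain F where F: "minimal_pair (Id_on (range to_ac)) w F F"
    using minimal_polynomial_exists[OF intermediate_field_base] .
  note FD = minimal_polynomialD[OF F]
  have "{x. poly F x = 0} = {w}"
    using conjugate_endo[OF F] fixed FD(3) by blast
  then have "Polynomial.degree F = 1"
    using minimal_polynomial_card_roots[OF F w] by simp
  then obtain a b where ab: "F = [:a, b:]" using degree1_coeffs by blast
  then have "F = [:a, 1:]" using FD(2) \<open>Polynomial.degree F = 1\<close> by (simp split: if_splits)
  then have "w = - a" "a \<in> range to_ac"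
    using FD(3) poly_overD[OF FD(1), of 0] by (auto simp: add_eq_0_iff)
  then show ?thesis by (auto simp flip: to_ac_minus)
qed

text \<open>A fixed element is written as a polynomial in \<open>w\<close> of degree below that of
  the minimal polynomial. It takes the same value at all conjugates of \<open>w\<close>, which are
  too many unless the polynomial is constant.\<close>

lemma galois_adjoin_radical:
  fixes c :: "'a::field"
  assumes w: "w ^ n = to_ac c" "c \<noteq> 0" "of_nat n \<noteq> (0::'a)"
    and roots: "\<And>z. z ^ n = 1 \<Longrightarrow> z \<in> adjoin w"
  shows "galois_extension (adjoin w)"
proof -
  let ?K = "range (to_ac :: 'a \<Rightarrow> _)"
  have base: "partial_hom (Id_on ?K)"
    using intermediate_field_base by (simp add: intermediate_field_iff_partial_hom)
  obtain F where F: "minimal_pair (Id_on ?K) w F F"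
    using minimal_polynomial_exists[OF intermediate_field_base] .
  note FD = minimal_polynomialD[OF F]
  have w0: "w \<noteq> 0"
    using w by (metis gr0I of_nat_0 to_ac_eq_0_iff zero_power)
  have "x \<in> ?K"
    if x: "x \<in> adjoin w" and fixed: "\<And>\<sigma>. \<sigma> \<in> automorphisms_over (adjoin w) \<Longrightarrow> \<sigma> x = x" for x
  proof -
  obtain P where P: "poly_over ?K P" "x = poly P w" using x by (auto simp: adjoin_eq)
  obtain A R where "P = F * A + R" "poly_over ?K R" and deg: "Polynomial.degree R < Polynomial.degree F"
    using coeffs_rel_division[OF base FD(1,2,5) P(1)] by (auto simp: coeffs_rel_Id_on)
  then have R: "poly_over ?K R" "x = poly R w" using P FD(3) by auto
  have const: "poly R w' = x" if w': "poly F w' = 0" for w'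
  proof -
    obtain \<sigma> where \<sigma>: "closure_endo \<sigma>" "\<sigma> w = w'" using conjugate_endo[OF F w'] .
    \<comment> \<open>A conjugate of \<open>w\<close> differs from it by an \<open>n\<close>-th root
      of unity, which lies in \<open>adjoin w\<close>. So the conjugate lies there too, and
      \<open>\<sigma>\<close> maps \<open>adjoin w\<close> into itself.\<close>
    have "w' ^ n = w ^ n"
      using closure_endo_simps[OF \<sigma>(1)] \<sigma>(2) w(1) by metis
    then have "(w' / w) ^ n = 1" using w0 by (simp add: power_divide)
    then have "w' / w * w \<in> adjoin w"
      by (intro intermediate_fieldD(3)[OF intermediate_field_adjoin] roots adjoin_self)
    then have "w' \<in> adjoin w" using w0 by simp
    have stable: "\<sigma> y \<in> adjoin w" if "y \<in> adjoin w" for y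
    proof -
      obtain Q where Q: "poly_over ?K Q" "y = poly Q w" using \<open>y \<in> adjoin w\<close> by (auto simp: adjoin_eq)
      then have "\<sigma> y = poly Q w'" using closure_endo_poly[OF \<sigma>(1) Q(1)] \<sigma>(2) by simp
      moreover have "poly_over (adjoin w) Q"
        using Q(1) intermediate_fieldD(1)[OF intermediate_field_adjoin, of _ w]
        by (simp add: coeffs_rel_Id_on image_iff) metis
      ultimately show ?thesis
        using poly_in_field[OF intermediate_field_adjoin] \<open>w' \<in> adjoin w\<close> by simp
    qed
    have "\<sigma> \<in> automorphisms_over (adjoin w)"
      using closure_endo_restrict[OF \<sigma>(1) intermediate_field_adjoin stable] .
    then show ?thesis using fixed closure_endo_poly[OF \<sigma>(1) R(1), of w] \<sigma>(2) R(2) by metis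
  qed
  \<comment> \<open>All roots of \<open>F\<close> are roots of the difference, and by separability
    they outnumber its degree.\<close>
  have "R - [:x:] = 0"
  proof (rule ccontr)
    assume *: "R - [:x:] \<noteq> 0"
    have "Polynomial.degree F = card {y. poly F y = 0}"
      using minimal_polynomial_card_roots[OF F w] by simp
    also have "\<dots> \<le> card {y. poly (R - [:x:]) y = 0}"
      using const by (intro card_mono poly_roots_finite *) auto
    also have "\<dots> \<le> Polynomial.degree (R - [:x:])" by (rule card_poly_roots_bound[OF *])
    also have "\<dots> < Polynomial.degree F"
      using deg by (intro degree_diff_less) auto
    finally show False by simp
  qed
  then have "R = [:x:]" by simp
  then show "x \<in> ?K" using poly_overD[OF R(1), of 0] by simp
  qed
  moreover have "x \<in> adjoin w \<and> (\<forall>\<sigma>\<in>automorphisms_over (adjoin w). \<sigma> x = x)" if "x \<in> ?K" for x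
    using that intermediate_fieldD(1)[OF intermediate_field_adjoin] by (auto simp: automorphisms_over_def)
  ultimately show ?thesis
    unfolding galois_extension_def using intermediate_field_adjoin by (intro conjI set_eqI iffI) auto
qed

text \<open>All elements are polynomials in \<open>w\<close>, so an automorphism over
  \<open>k\<close> is determined by its value at \<open>w\<close>.\<close>

lemma abelian_adjoinI:
  assumes gal: "galois_extension (adjoin w)"
    and comm: "\<And>\<sigma> \<tau>. \<sigma> \<in> automorphisms_over (adjoin w) \<Longrightarrow> \<tau> \<in> automorphisms_over (adjoin w) \<Longrightarrow>
      \<sigma> (\<tau> w) = \<tau> (\<sigma> w)"
  shows "abelian_extension (adjoin w)"
  unfolding abelian_extension_def
proof (intro conjI ballI gal)
  fix \<sigma> \<tau> x
  assume *: "\<sigma> \<in> automorphisms_over (adjoin w)" "\<tau> \<in> automorphisms_over (adjoin w)" "x \<in> adjoin w"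
  obtain P where P: "poly_over (range to_ac) P" "x = poly P w" using *(3) by (auto simp: adjoin_eq)
  note poly = automorphism_poly[OF intermediate_field_adjoin _ P(1)]
  have "\<rho> w \<in> adjoin w" if "\<rho> \<in> automorphisms_over (adjoin w)" for \<rho>
    using automorphism_closed[OF that] adjoin_self by blast
  then have "\<sigma> (\<tau> (poly P w)) = poly P (\<sigma> (\<tau> w))" "\<tau> (\<sigma> (poly P w)) = poly P (\<tau> (\<sigma> w))"
    using poly[OF *(1)] poly[OF *(2)] *(1,2) adjoin_self[of w] by metis+
  then show "\<sigma> (\<tau> x) = \<tau> (\<sigma> x)"
    using comm[OF *(1,2)] P(2) by simp
qed

section \<open>Powers under automorphisms, and primitive roots of unity\<close>

lemma automorphism_mult:
  "\<sigma> \<in> automorphisms_over L \<Longrightarrow> x \<in> L \<Longrightarrow> y \<in> L \<Longrightarrow> \<sigma> (x * y) = \<sigma> x * \<sigma> y"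
  by (auto simp: automorphisms_over_def ring_iso_def ring_hom_def)

lemma automorphism_to_ac: "\<sigma> \<in> automorphisms_over L \<Longrightarrow> \<sigma> (to_ac c) = to_ac c"
  by (simp add: automorphisms_over_def)

lemma automorphism_power:
  assumes "\<sigma> \<in> automorphisms_over L" "intermediate_field L" "x \<in> L"
  shows "\<sigma> (x ^ n) = \<sigma> x ^ n"
proof (induction n)
  case 0
  then show ?case using automorphism_to_ac[OF assms(1), of 1] by simp
next
  case (Suc n)
  then show ?case
    using automorphism_mult[OF assms(1,3) intermediate_fieldD(8)[OF assms(2,3), of n]] by simp
qed

text \<open>The exact order of \<open>z\<close> as a divisibility criterion. Positivity of
  \<open>r\<close> excludes elements none of whose positive powers is 1, which satisfy the criterion
  with \<open>r = 0\<close>.\<close>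

definition primitive_root_of_unity :: "nat \<Rightarrow> 'a::field \<Rightarrow> bool" where
  "primitive_root_of_unity r z \<longleftrightarrow> r > 0 \<and> (\<forall>m. z ^ m = 1 \<longleftrightarrow> r dvd m)"

lemma primitive_root_of_unity_exists:
  fixes z :: "'a::field"
  assumes "z ^ n = 1" "n > 0"
  obtains r where "primitive_root_of_unity r z" "r dvd n"
proof -
  define r where "r = (LEAST r. r > 0 \<and> z ^ r = 1)"
  have r: "r > 0" "z ^ r = 1"
    using LeastI[of "\<lambda>r. r > 0 \<and> z ^ r = 1" n] assms by (auto simp: r_def)
  have least: "r \<le> i" if "i > 0" "z ^ i = 1" for i
    using Least_le[of "\<lambda>r. r > 0 \<and> z ^ r = 1" i] that by (auto simp: r_def)
  have "r dvd m" if "z ^ m = 1" for m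
  proof -
    have "z ^ m = (z ^ r) ^ (m div r) * z ^ (m mod r)"
      by (metis div_mult_mod_eq mult.commute power_add power_mult)
    then have "z ^ (m mod r) = 1" using that r by simp
    then have "m mod r = 0" using least[of "m mod r"] r(1) by (metis gr0I leD mod_less_divisor)
    then show ?thesis by auto
  qed
  moreover have "z ^ m = 1" if "r dvd m" for m
    using that r(2) by (auto simp: power_mult)
  ultimately have "primitive_root_of_unity r z"
    using r(1) by (auto simp: primitive_root_of_unity_def)
  then show ?thesis using that assms(1) by (auto simp: primitive_root_of_unity_def)
qed

lemma card_roots_of_unity_le:
  fixes n :: nat
  assumes "n > 0"
  shows "card {x::'a::field. x ^ n = 1} \<le> n" "finite {x::'a. x ^ n = 1}"
proof -
  let ?P = "Polynomial.monom 1 n - [:1::'a:]"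
  have P: "?P \<noteq> 0" using degree_binomial[OF assms, of "1::'a"] assms by auto
  have "{x::'a. x ^ n = 1} = {x. poly ?P x = 0}" by (auto simp: poly_monom)
  then show "card {x::'a. x ^ n = 1} \<le> n" "finite {x::'a. x ^ n = 1}"
    using card_poly_roots_bound[OF P] poly_roots_finite[OF P] degree_binomial[OF assms, of "1::'a"] by auto
qed

text \<open>The first \<open>r\<close> powers of \<open>z\<close> are distinct, and
  \<open>x ^ r = 1\<close> has at most \<open>r\<close> solutions.\<close>

lemma primitive_root_of_unity_powers:
  fixes z :: "'a::field"
  assumes "primitive_root_of_unity r z"
  shows "card {x::'a. x ^ r = 1} = r" "{x. x ^ r = 1} = (\<lambda>i. z ^ i) ` {..<r}"
proof -
  have r: "r > 0" and z: "\<And>m. z ^ m = 1 \<longleftrightarrow> r dvd m"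
    using assms by (auto simp: primitive_root_of_unity_def)
  have z0: "z \<noteq> 0" using z[of r] r by (metis dvd_refl power_0_left neq0_conv zero_neq_one)
  have *: "i = j" if "i \<le> j" "j < r" "z ^ i = z ^ j" for i j
  proof -
    have "z ^ (j - i) = 1" using that z0 by (simp add: power_diff)
    then show ?thesis using z[of "j - i"] that by (auto dest: dvd_imp_le)
  qed
  have "inj_on (\<lambda>i. z ^ i) {..<r}"
  proof (rule inj_onI)
    fix i j assume "i \<in> {..<r}" "j \<in> {..<r}" "z ^ i = z ^ j"
    then show "i = j" using *[of i j] *[of j i] by (cases "i \<le> j") auto
  qed
  then have c: "card ((\<lambda>i. z ^ i) ` {..<r}) = r" by (simp add: card_image)
  have sub: "(\<lambda>i. z ^ i) ` {..<r} \<subseteq> {x. x ^ r = 1}"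
    using z by (auto simp flip: power_mult)
  then show eq: "{x. x ^ r = 1} = (\<lambda>i. z ^ i) ` {..<r}"
    using card_roots_of_unity_le[OF r, where 'a='a] c by (metis card_seteq)
  then show "card {x::'a. x ^ r = 1} = r" using c by simp
qed

lemma primitive_root_of_unity_powerE:
  fixes z x :: "'a::field"
  assumes "primitive_root_of_unity r z" "x ^ r = 1"
  obtains i where "x = z ^ i"
  using primitive_root_of_unity_powers(2)[OF assms(1)] assms(2) by blast

text \<open>Every automorphism sends \<open>z\<close> to one of its powers, and power maps
  commute.\<close>

lemma abelian_adjoin_root_of_unity:
  fixes z :: "'a::field alg_closure"
  assumes z: "primitive_root_of_unity r z" "of_nat r \<noteq> (0::'a)"
  shows "abelian_extension (adjoin z)"
proof (rule abelian_adjoinI)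
  have zr: "z ^ r = 1" using z(1) by (simp add: primitive_root_of_unity_def)
  note Kf = intermediate_field_adjoin[of z]
  show "galois_extension (adjoin z)"
  proof (rule galois_adjoin_radical)
    show "z ^ r = to_ac 1" "(1::'a) \<noteq> 0" "of_nat r \<noteq> (0::'a)" using zr z by auto
    show "x \<in> adjoin z" if "x ^ r = 1" for x
      using primitive_root_of_unity_powerE[OF z(1) that] intermediate_fieldD(8)[OF Kf] adjoin_self by metis
  qed
  fix \<sigma> \<tau> assume *: "\<sigma> \<in> automorphisms_over (adjoin z)" "\<tau> \<in> automorphisms_over (adjoin z)"
  have ex: "\<exists>i. \<rho> z = z ^ i" if \<rho>: "\<rho> \<in> automorphisms_over (adjoin z)" for \<rho>
  proof -
    have "\<rho> z ^ r = 1"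
      using automorphism_power[OF \<rho> Kf adjoin_self, of r] zr automorphism_to_ac[OF \<rho>, of 1] by simp
    then show ?thesis using primitive_root_of_unity_powerE[OF z(1)] by metis
  qed
  obtain i j where "\<sigma> z = z ^ i" "\<tau> z = z ^ j" using ex * by metis
  then show "\<sigma> (\<tau> z) = \<tau> (\<sigma> z)"
    using automorphism_power[OF *(1) Kf adjoin_self] automorphism_power[OF *(2) Kf adjoin_self]
    by (simp add: mult.commute flip: power_mult)
qed

text \<open>Every automorphism multiplies \<open>w\<close> by a root of unity lying in
  \<open>k\<close>. All automorphisms fix these factors, so they commute.\<close>

lemma abelian_adjoin_kummer:
  fixes c :: "'a::field"
  assumes w: "w ^ n = to_ac c" "c \<noteq> 0" "of_nat n \<noteq> (0::'a)"
    and roots: "\<And>z. z ^ n = 1 \<Longrightarrow> z \<in> range (to_ac :: 'a \<Rightarrow> _)"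
  shows "abelian_extension (adjoin w)"
proof (rule abelian_adjoinI)
  note Kf = intermediate_field_adjoin[of w]
  have w0: "w \<noteq> 0"
    using w by (metis gr0I of_nat_0 to_ac_eq_0_iff zero_power)
  show "galois_extension (adjoin w)"
  proof (rule galois_adjoin_radical[OF w])
    show "z \<in> adjoin w" if "z ^ n = 1" for z
      using roots[OF that] intermediate_fieldD(1)[OF Kf] by auto
  qed
  fix \<sigma> \<tau> assume *: "\<sigma> \<in> automorphisms_over (adjoin w)" "\<tau> \<in> automorphisms_over (adjoin w)"
  have ex: "\<exists>a. \<rho> w = to_ac a * w" if \<rho>: "\<rho> \<in> automorphisms_over (adjoin w)" for \<rho>
  proof -
    have "\<rho> w ^ n = w ^ n"
      using automorphism_power[OF \<rho> Kf adjoin_self, of n] w(1) automorphism_to_ac[OF \<rho>, of c] by simp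
    then have "(\<rho> w / w) ^ n = 1" using w0 by (simp add: power_divide)
    then obtain a where "\<rho> w / w = to_ac a" using roots by blast
    then show ?thesis using w0 by (metis nonzero_divide_eq_eq)
  qed
  obtain a b where ab: "\<sigma> w = to_ac a * w" "\<tau> w = to_ac b * w" using ex * by metis
  have scale: "\<rho> (to_ac d * w) = to_ac d * \<rho> w" if "\<rho> \<in> automorphisms_over (adjoin w)" for \<rho> d
    using automorphism_mult[OF that intermediate_fieldD(1)[OF Kf] adjoin_self] automorphism_to_ac[OF that]
    by simp
  show "\<sigma> (\<tau> w) = \<tau> (\<sigma> w)"
    using scale[OF *(1), of b] scale[OF *(2), of a] ab by simp
qed

section \<open>Elements of the maximal abelian extension\<close>

lemma abelian_subset_maximal: "abelian_extension L \<Longrightarrow> L \<subseteq> maximal_abelian_extension"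
  unfolding maximal_abelian_extension_def by (auto intro: generate_field.incl)

lemma intermediate_field_maximal_abelian:
  "intermediate_field (maximal_abelian_extension :: 'a::field alg_closure set)"
proof -
  \<comment> \<open>This abelian extension puts \<open>k\<close> into the generating set.\<close>
  have "abelian_extension (adjoin (1 :: 'a alg_closure))"
    by (rule abelian_adjoin_root_of_unity[of 1]) (auto simp: primitive_root_of_unity_def)
  then show ?thesis
    unfolding maximal_abelian_extension_def
    using intermediate_fieldD(1)[OF intermediate_field_adjoin[of "1 :: 'a alg_closure"]]
    by (intro intermediate_field_generate) blast
qed

lemma root_of_unity_in_maximal_abelian:
  fixes z :: "'a::field alg_closure"
  assumes "z ^ n = 1" "of_nat n \<noteq> (0::'a)"
  shows "z \<in> maximal_abelian_extension"
proof -
  have "n > 0" using assms(2) by (metis gr0I of_nat_0)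
  then obtain r where r: "primitive_root_of_unity r z" "r dvd n"
    using primitive_root_of_unity_exists[OF assms(1)] by blast
  have "of_nat r \<noteq> (0::'a)" using r(2) assms(2) by auto
  then show ?thesis
    using abelian_subset_maximal[OF abelian_adjoin_root_of_unity[OF r(1)]] adjoin_self by blast
qed

section \<open>Radicals in the maximal abelian extension\<close>

lemma primary_roots_of_unity_iff:
  assumes "Factorial_Ring.prime p"
  shows "x \<in> primary_roots_of_unity p \<longleftrightarrow> (\<exists>d. x ^ (p ^ d) = 1)"
proof -
  have "1 \<le> p ^ d" for d using prime_gt_0_nat[OF assms] by (simp add: Suc_le_eq)
  then show ?thesis unfolding primary_roots_of_unity_def roots_of_unity_def by blast
qed

text \<open>The arithmetic shared by irreducibility and the bound on radicals: two powers of
  \<open>u\<close> and \<open>b\<close> agree up to sign, and \<open>p\<close> divides the exponent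
  of \<open>u\<close> less often than that of \<open>b\<close>.\<close>

lemma primary_root_times_power_cancel:
  fixes u b :: "'a::field"
  assumes p: "Factorial_Ring.prime p" and u: "u \<noteq> 0" and w: "\<not> p dvd w" and ij: "i < j"
    and eq: "u ^ (p ^ i * w) = e * b ^ (p ^ j * w')" and e: "e = 1 \<or> e = -1"
  shows "u \<in> {\<zeta> * v ^ p | \<zeta> v. \<zeta> \<in> primary_roots_of_unity p \<and> v \<noteq> 0}"
proof -
  obtain m where j: "j = Suc (i + m)" using ij less_iff_Suc_add by blast
  define y where "y = b ^ (p ^ m * w')"
  have "p ^ j * w' = p ^ m * w' * p * p ^ i" by (simp add: j power_add)
  then have "b ^ (p ^ j * w') = (y ^ p) ^ p ^ i" by (simp only: y_def power_mult)
  moreover have "u ^ (p ^ i * w) = (u ^ w) ^ p ^ i" by (simp only: power_mult mult.commute)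
  ultimately have eq': "(u ^ w) ^ p ^ i = e * (y ^ p) ^ p ^ i" using eq by simp
  have "y \<noteq> 0"
  proof
    assume "y = 0"
    then have "(u ^ w) ^ p ^ i = 0" using eq' prime_gt_0_nat[OF p] by (simp add: zero_power)
    then show False using u by simp
  qed
  \<comment> \<open>\<open>u ^ w\<close> and \<open>y ^ p\<close> have the same
    \<open>p ^ i\<close>-th power up to the sign \<open>e\<close>; \<open>q\<close> is the factor
    between them.\<close>
  define q where "q = u ^ w / y ^ p"
  have q: "q ^ p ^ i = e" "u ^ w = q * y ^ p"
    using eq' \<open>y \<noteq> 0\<close> by (auto simp: q_def power_divide)
  \<comment> \<open>The sign is absorbed: for \<open>p = 2\<close> one more squaring removes it, and
    for odd \<open>p\<close> it is its own \<open>p\<close>-th power and can be moved into both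
    \<open>q\<close> and \<open>y\<close>.\<close>
  obtain q' y' d where q': "q' ^ (p ^ d) = 1" "u ^ w = q' * y' ^ p" "y' \<noteq> 0"
  proof (cases "p = 2")
    case True
    have "q ^ (p ^ Suc i) = (q ^ p ^ i) ^ p" by (simp only: power_Suc2 power_mult)
    then have "q ^ (p ^ Suc i) = 1" using q(1) e True by auto
    then show ?thesis using that q(2) \<open>y \<noteq> 0\<close> by blast
  next
    case False
    then have "odd p" using p primes_dvd_imp_eq two_is_prime_nat by blast
    then have "(e * q) ^ (p ^ i) = 1"
      using q(1) e by (auto simp: power_mult_distrib)
    moreover have "u ^ w = (e * q) * (e * y) ^ p"
      using q(2) e \<open>odd p\<close> by auto
    ultimately show ?thesis using that[of "e * q" i "e * y"] e \<open>y \<noteq> 0\<close> by auto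
  qed
  have "coprime w p" using p w by (metis coprime_commute prime_imp_coprime)
  moreover have "w \<noteq> 0" using w by (metis dvd_0_right)
  \<comment> \<open>As \<open>w\<close> is invertible modulo \<open>p\<close>, the power
    \<open>a\<close> turns \<open>u ^ w\<close> into \<open>u\<close> times a \<open>p\<close>-th
    power.\<close>
  ultimately obtain a k where k: "w * a = 1 + p * k"
    using bezout_nat[of w p] by (auto simp: coprime_iff_gcd_eq_1)
  have "u * (u ^ k) ^ p = (u ^ w) ^ a" using k by (simp add: mult.commute flip: power_mult power_Suc power_add)
  also have "\<dots> = q' ^ a * (y' ^ a) ^ p" using q'(2) by (simp add: power_mult_distrib mult.commute flip: power_mult)
  finally have "u = q' ^ a * (y' ^ a / u ^ k) ^ p" using u by (simp add: power_divide field_simps)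
  moreover have "(q' ^ a) ^ (p ^ d) = 1" using q'(1) by (metis mult.commute power_mult power_one)
  ultimately show ?thesis
    using primary_roots_of_unity_iff[OF p, of "q' ^ a"] q'(3) u
    by (intro CollectI exI[of _ "q' ^ a"] exI[of _ "y' ^ a / u ^ k"]) auto
qed

section \<open>Roots of unity of prime power order\<close>

lemma primitive_root_of_unity_power:
  assumes "primitive_root_of_unity (a * b) z"
  shows "primitive_root_of_unity b (z ^ a)"
  using assms by (auto simp: primitive_root_of_unity_def simp flip: power_mult)

lemma primitive_prime_power_root_mono:
  assumes "primitive_root_of_unity (p ^ j) z" "i \<le> j"
  shows "primitive_root_of_unity (p ^ i) (z ^ p ^ (j - i))"
  using assms by (intro primitive_root_of_unity_power) (simp flip: power_add)

lemma primary_root_primitive: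
  assumes "Factorial_Ring.prime p" "x ^ (p ^ d) = 1"
  obtains i where "i \<le> d" "primitive_root_of_unity (p ^ i) x"
proof -
  have "p ^ d > 0" using prime_gt_0_nat[OF assms(1)] by simp
  then obtain r where r: "primitive_root_of_unity r x" "r dvd p ^ d"
    using primitive_root_of_unity_exists[OF assms(2)] by blast
  then obtain i where "i \<le> d" "r = p ^ i"
    using divides_primepow_nat[OF assms(1)] by blast
  then show ?thesis using that r(1) by blast
qed

text \<open>This replaces cardinalities by the existence of roots of unity. If \<open>p ^ D\<close>
  is the largest order, the group consists of the \<open>p ^ D\<close> solutions of
  \<open>x ^ p ^ D = 1\<close>; if orders are unbounded, it has subsets of every size
  \<open>p ^ j\<close> and is infinite.\<close>

lemma lambda_exponent_ge_iff:
  assumes p: "Factorial_Ring.prime p"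
  shows "enat j \<le> lambda_exponent TYPE('a::field) p \<longleftrightarrow> (\<exists>z::'a. primitive_root_of_unity (p ^ j) z)"
proof -
  define S where "S = {j. \<exists>z::'a. primitive_root_of_unity (p ^ j) z}"
  let ?M = "primary_roots_of_unity p :: 'a set"
  have p1: "p > 1" using p prime_gt_1_nat by blast
  have down: "i \<in> S" if "j \<in> S" "i \<le> j" for i j
    using that primitive_prime_power_root_mono unfolding S_def by blast
  have "primitive_root_of_unity (p ^ 0) (1 :: 'a)" by (simp add: primitive_root_of_unity_def)
  then have S0: "0 \<in> S" unfolding S_def by blast
  have sub: "{x. x ^ (p ^ j) = 1} \<subseteq> ?M" for j using primary_roots_of_unity_iff[OF p] by blast
  have card: "card {x::'a. x ^ (p ^ j) = 1} = p ^ j" if "j \<in> S" for j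
    using that primitive_root_of_unity_powers(1) unfolding S_def by blast
  have "enat j \<le> lambda_exponent TYPE('a) p \<longleftrightarrow> j \<in> S"
  proof (cases "finite S")
    case True
    define D where "D = Max S"
    have D: "D \<in> S" using Max_in[OF True] S0 unfolding D_def by blast
    have le: "i \<le> D" if "i \<in> S" for i using True that by (simp add: D_def)
    have "?M \<subseteq> {x. x ^ (p ^ D) = 1}"
    proof
      fix x :: 'a assume "x \<in> ?M"
      then obtain d where "x ^ (p ^ d) = 1" using primary_roots_of_unity_iff[OF p] by blast
      then obtain i where i: "primitive_root_of_unity (p ^ i) x" using primary_root_primitive[OF p] by blast
      then have "i \<le> D" using le unfolding S_def by blast
      then have "p ^ i dvd p ^ D" by (rule le_imp_power_dvd)
      then show "x \<in> {x. x ^ (p ^ D) = 1}" using i by (auto simp: primitive_root_of_unity_def)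
    qed
    then have M: "?M = {x. x ^ (p ^ D) = 1}" using sub by blast
    then have "finite ?M" using card_roots_of_unity_le(2)[of "p ^ D", where 'a='a] p1 by simp
    moreover have "(THE l. card ?M = p ^ l) = D"
      unfolding M card[OF D] using p1 by (intro the_equality) auto
    ultimately have "lambda_exponent TYPE('a) p = enat D" by (simp add: lambda_exponent_def)
    then show ?thesis using down[OF D, of j] le[of j] by auto
  next
    case False
    then have all: "i \<in> S" for i 
    proof -
      obtain j where "j \<in> S" "i < j" using False by (meson infinite_nat_iff_unbounded)
      then show ?thesis using down by simp
    qed
    have "infinite ?M"
    proof
      assume fin: "finite ?M"
      \<comment> \<open>The cardinality itself serves as exponent because \<open>p ^ j\<close>
        always exceeds \<open>j\<close>.\<close>
      have "p ^ card ?M \<le> card ?M" using card_mono[OF fin sub] card[OF all] by metis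
      then show False using power_gt_expt[of p "card ?M"] p1 by simp
    qed
    then show ?thesis using all by (simp add: lambda_exponent_def)
  qed
  then show ?thesis by (simp add: S_def)
qed

text \<open>A count: by separability \<open>x ^ p ^ f = 1\<close> has \<open>p ^ f\<close>
  solutions, too many for all of them to satisfy \<open>x ^ p ^ g = 1\<close> with
  \<open>f = g + 1\<close>. A remaining one has exact order \<open>p ^ f\<close>.\<close>

lemma primitive_prime_power_root_exists:
  fixes p :: nat
  assumes p: "Factorial_Ring.prime p" "of_nat p \<noteq> (0::'a::alg_closed_field)"
  obtains z :: "'a::alg_closed_field" where "primitive_root_of_unity (p ^ f) z"
proof (cases f)
  case 0
  then show ?thesis using that[of 1] by (simp add: primitive_root_of_unity_def)
next
  case (Suc g)
  have p1: "p > 1" using p prime_gt_1_nat by blast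
  let ?P = "Polynomial.monom 1 (p ^ f) - [:1::'a:]"
  have "card {x. poly ?P x = 0} = Polynomial.degree ?P"
    using p p1 by (intro binomial_divisor_card_roots[of _ "p ^ f" 1] lead_coeff_binomial) auto
  then have "card {x::'a. x ^ p ^ f = 1} = p ^ f"
    using degree_binomial[of "p ^ f" "1::'a"] p1 by (simp add: poly_monom)
  moreover have "card {x::'a. x ^ p ^ g = 1} \<le> p ^ g" "finite {x::'a. x ^ p ^ g = 1}"
    using card_roots_of_unity_le[of "p ^ g"] p1 by auto
  moreover have "p ^ g < p ^ f" using p1 Suc by simp
  ultimately have "\<not> {x::'a. x ^ p ^ f = 1} \<subseteq> {x. x ^ p ^ g = 1}"
    using card_mono by (metis leD le_less_trans)
  then obtain z :: 'a where z: "z ^ p ^ f = 1" "z ^ p ^ g \<noteq> 1" by blast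
  then obtain i where i: "i \<le> f" "primitive_root_of_unity (p ^ i) z"
    using primary_root_primitive[OF p(1)] by blast
  have "\<not> i \<le> g" using i(2) z(2) le_imp_power_dvd unfolding primitive_root_of_unity_def by blast
  then show ?thesis using that i Suc by (metis le_SucE)
qed

lemma primitive_root_of_unity_to_ac:
  "primitive_root_of_unity r (to_ac z) \<longleftrightarrow> primitive_root_of_unity r z"
  by (simp add: primitive_root_of_unity_def flip: to_ac_power)

text \<open>If \<open>\<tau>\<close> raises the roots of unity of order \<open>p ^ f\<close> to the power \<open>c + 1\<close>, then
  \<open>\<tau> s / s ^ (c + 1)\<close> is fixed by every \<open>\<sigma>\<close>, because \<open>\<sigma>\<close> commutes with \<open>\<tau>\<close> at \<open>s\<close>. So it lies in
  \<open>k\<close>, which makes \<open>u ^ c\<close> a \<open>p ^ f\<close>-th power in \<open>k\<close>. If \<open>\<lambda> < f\<close>, then \<open>\<tau>\<close> can be chosen with \<open>c\<close>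
  not divisible by \<open>p ^ (\<lambda> + 1)\<close>.\<close>

lemma radical_in_maximal_abelian:
  fixes u :: "'a::field"
  assumes p: "Factorial_Ring.prime p" "of_nat p \<noteq> (0::'a)" and u: "u \<noteq> 0"
    "u \<notin> {\<zeta> * v ^ p | \<zeta> v. \<zeta> \<in> primary_roots_of_unity p \<and> v \<noteq> 0}"
    and s: "s ^ p ^ f = to_ac u" "s \<in> maximal_abelian_extension"
  shows "enat f \<le> lambda_exponent TYPE('a) p"
proof (rule ccontr)
  assume "\<not> ?thesis"
  then obtain l where l: "lambda_exponent TYPE('a) p = enat l" "l < f"
    by (cases "lambda_exponent TYPE('a) p") auto
  have pf: "of_nat (p ^ i) \<noteq> (0::'a)" for i using p(2) by simp
  have p1: "p > 1" using p(1) prime_gt_1_nat by blast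
  have "of_nat p \<noteq> (0::'a alg_closure)" using p(2) by (metis to_ac_eq_0_iff to_ac_of_nat)
  then obtain \<xi> :: "'a alg_closure" where \<xi>: "primitive_root_of_unity (p ^ f) \<xi>"
    using primitive_prime_power_root_exists[OF p(1)] by blast
  \<comment> \<open>Its order is the first power of \<open>p\<close> that is not the order of an
    element of \<open>k\<close>, so some endomorphism \<open>\<tau>\<close> moves it.\<close>
  define \<eta> where "\<eta> = \<xi> ^ p ^ (f - Suc l)"
  have \<eta>: "primitive_root_of_unity (p ^ Suc l) \<eta>"
    using primitive_prime_power_root_mono[OF \<xi>, of "Suc l"] l(2) by (simp add: \<eta>_def)
  have "\<eta> \<notin> range (to_ac :: 'a \<Rightarrow> _)"
  proof
    assume "\<eta> \<in> range (to_ac :: 'a \<Rightarrow> _)"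
    then obtain z :: 'a where "primitive_root_of_unity (p ^ Suc l) z"
      using \<eta> primitive_root_of_unity_to_ac by blast
    then have "enat (Suc l) \<le> lambda_exponent TYPE('a) p"
      using lambda_exponent_ge_iff[OF p(1)] by blast
    then show False using l(1) by simp
  qed
  moreover have "\<eta> ^ p ^ Suc l = to_ac 1"
    using \<eta> by (simp only: primitive_root_of_unity_def to_ac_1 dvd_refl)
  ultimately obtain \<tau> where \<tau>: "closure_endo \<tau>" "\<tau> \<eta> \<noteq> \<eta>"
    using fixed_radical_in_base[OF _ one_neq_zero pf] by blast
  note \<tau>s = closure_endo_simps[OF \<tau>(1)]
  have one: "\<sigma> 1 = 1" if "closure_endo \<sigma>" for \<sigma> :: "'a alg_closure \<Rightarrow> _"
    using closure_endo_simps(1)[OF that, of 1] by simp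
  have \<xi>1: "\<xi> ^ p ^ f = 1" using \<xi> by (simp add: primitive_root_of_unity_def)
  then have "\<tau> \<xi> ^ p ^ f = 1" using \<tau>s(4) one[OF \<tau>(1)] by metis
  then obtain c0 where "\<tau> \<xi> = \<xi> ^ c0" using primitive_root_of_unity_powerE[OF \<xi>] by blast
  \<comment> \<open>Since \<open>\<xi> ^ p ^ f = 1\<close>, adding \<open>p ^ f - 1\<close> to the
    exponent amounts to subtracting 1; so \<open>c\<close> plays the part of \<open>c0 - 1\<close>
    even when \<open>c0 = 0\<close>.\<close>
  then have c: "\<tau> \<xi> = \<xi> ^ Suc (c0 + (p ^ f - 1))"
    using \<xi>1 p1 by (simp add: power_add flip: power_Suc)
  define c where "c = c0 + (p ^ f - 1)"
  have \<tau>\<xi>: "\<tau> \<xi> = \<xi> ^ Suc c" using c by (simp add: c_def)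
  have "\<tau> \<eta> = \<eta> ^ Suc c" unfolding \<eta>_def using \<tau>\<xi> \<tau>s(4) by (metis mult.commute power_mult)
  then have "\<eta> ^ c \<noteq> 1" using \<tau>(2) by auto
  then have ndvd: "\<not> p ^ Suc l dvd c" using \<eta> by (simp add: primitive_root_of_unity_def)
  have s0: "s \<noteq> 0" using s(1) u(1) p1 by (metis gr0I less_nat_zero_code power_eq_0_iff to_ac_eq_0_iff zero_power)
  define y where "y = \<tau> s / s ^ Suc c"
  have yp: "y ^ p ^ f = to_ac (u / u ^ Suc c)"
  proof -
    have "\<tau> s ^ p ^ f = to_ac u" using s(1) \<tau>s(1,4) by metis
    moreover have "(s ^ Suc c) ^ p ^ f = to_ac u ^ Suc c" using s(1) by (metis mult.commute power_mult)
    ultimately show ?thesis by (simp only: y_def power_divide to_ac_divide to_ac_power)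
  qed
  have "y \<in> range to_ac"
  proof (rule fixed_radical_in_base[OF yp _ pf])
    show "u / u ^ Suc c \<noteq> 0" using u(1) by simp
    fix \<sigma> :: "'a alg_closure \<Rightarrow> 'a alg_closure" assume \<sigma>: "closure_endo \<sigma>"
    note \<sigma>s = closure_endo_simps[OF \<sigma>]
    have "\<sigma> s ^ p ^ f = s ^ p ^ f" using s(1) \<sigma>s(1,4) by metis
    then have "(\<sigma> s / s) ^ p ^ f = 1" using s0 by (simp add: power_divide)
    then obtain j where "\<sigma> s / s = \<xi> ^ j" using primitive_root_of_unity_powerE[OF \<xi>] by blast
    then have \<sigma>s': "\<sigma> s = \<xi> ^ j * s" using s0 by (simp add: field_simps)
    have "\<sigma> (\<tau> s) = \<tau> (\<xi> ^ j * s)" using closure_endos_commute[OF \<sigma> \<tau>(1) s(2)] \<sigma>s' by simp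
    also have "\<dots> = \<xi> ^ (Suc c * j) * \<tau> s" by (simp only: \<tau>s \<tau>\<xi> power_mult)
    finally have "\<sigma> (\<tau> s) = \<xi> ^ (Suc c * j) * \<tau> s" .
    moreover have "\<sigma> (s ^ Suc c) = \<xi> ^ (Suc c * j) * s ^ Suc c"
      by (simp only: \<sigma>s(4) \<sigma>s' power_mult_distrib mult.commute[of "Suc c" j] power_mult)
    moreover have "\<xi> \<noteq> 0" using \<xi>1 p1 by (auto simp: zero_power)
    ultimately show "\<sigma> y = y" unfolding y_def \<sigma>s(6) by simp
  qed
  then obtain v where v: "y = to_ac v" by blast
  then have "to_ac (v ^ p ^ f) = to_ac (u / u ^ Suc c)" using yp by simp
  then have "v ^ p ^ f = u / u ^ Suc c" by (simp only: to_ac_eq_iff)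
  then have vp: "u ^ c = (1 / v) ^ p ^ f" 
  proof -
    have "u ^ c * v ^ p ^ f = 1" using \<open>v ^ p ^ f = u / u ^ Suc c\<close> u(1) by simp
    then show ?thesis by (metis inverse_unique inverse_eq_divide mult.commute power_one_over)
  qed
  have "c \<noteq> 0" using ndvd by (metis dvd_0_right)
  then obtain w where w: "c = p ^ multiplicity p c * w" "\<not> p dvd w"
    using multiplicity_decompose'[of c p] p1 by (metis nat_dvd_1_iff_1 less_irrefl)
  \<comment> \<open>Thus \<open>p\<close> divides \<open>c\<close> at most \<open>l < f\<close>
    times, and \<open>u ^ c\<close> being a \<open>p ^ f\<close>-th power contradicts the hypothesis
    on \<open>u\<close>.\<close>
  have "\<not> Suc l \<le> multiplicity p c" using ndvd multiplicity_dvd' by blast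
  then have "multiplicity p c < f" using l(2) by simp
  then have "u \<in> {\<zeta> * v ^ p | \<zeta> v. \<zeta> \<in> primary_roots_of_unity p \<and> v \<noteq> 0}"
    using primary_root_times_power_cancel[OF p(1) u(1) w(2), of _ f 1 "1 / v" 1] vp w(1) by simp
  then show False using u(2) by contradiction
qed

section \<open>Irreducibility and the intersection\<close>

lemma map_poly_to_ac_mult: "map_poly to_ac (P * Q) = map_poly to_ac P * map_poly to_ac Q"
  by (intro poly_eqI) (simp add: coeff_map_poly coeff_mult to_ac_sum)

lemma multiplicity_lessE:
  fixes r n :: nat
  assumes "0 < r" "r < n"
  obtains p where "Factorial_Ring.prime p" "multiplicity p r < multiplicity p n"
proof -
  have "\<not> n dvd r" using assms by (auto dest: dvd_imp_le)
  then show ?thesis using that multiplicity_le_imp_dvd[of n r] assms by (metis not_le gr_implies_not0)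
qed

lemma binomial_irreducible:
  fixes u :: "'a::field"
  assumes n: "n \<ge> 1" and u: "u \<noteq> 0"
    and np: "\<And>p. Factorial_Ring.prime p \<Longrightarrow> p dvd n \<Longrightarrow>
           u \<notin> {\<zeta> * v ^ p | \<zeta> v. \<zeta> \<in> primary_roots_of_unity p \<and> v \<noteq> 0}"
  shows "Factorial_Ring.irreducible (Polynomial.monom 1 n - [:u:])"
proof (rule Factorial_Ring.irreducibleI)
  let ?B = "Polynomial.monom 1 n - [:u:]"
  have deg: "Polynomial.degree ?B = n" using n by (intro degree_binomial) simp
  then show B0: "?B \<noteq> 0" using n by auto
  show "\<not> ?B dvd 1" using B0 deg n by (simp add: is_unit_iff_degree)
  show "P dvd 1 \<or> Q dvd 1" if PQ: "?B = P * Q" for P Q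
  proof (rule ccontr)
    assume "\<not> (P dvd 1 \<or> Q dvd 1)"
    moreover have nz: "P \<noteq> 0" "Q \<noteq> 0" using PQ B0 by auto
    ultimately have pos: "Polynomial.degree P > 0" "Polynomial.degree Q > 0"
      by (auto simp: is_unit_iff_degree)
    define r where "r = Polynomial.degree P"
    have "n = r + Polynomial.degree Q" using deg nz by (simp add: PQ degree_mult_eq r_def)
    then have r: "0 < r" "r < n" using pos by (auto simp: r_def)
    \<comment> \<open>The contradiction will arise at this prime, which divides the degree
      \<open>r\<close> of the factor less often than \<open>n\<close>.\<close>
    obtain p where p: "Factorial_Ring.prime p" "multiplicity p r < multiplicity p n"
      using multiplicity_lessE[OF r] .
    \<comment> \<open>The factor is made monic and viewed over the closure, where its constant
      coefficient is known.\<close>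
    define P' where "P' = smult (inverse (Polynomial.lead_coeff P)) P"
    define F where "F = map_poly to_ac P'"
    have P': "Polynomial.lead_coeff P' = 1" "Polynomial.degree P' = r" "P' dvd ?B"
      using nz PQ by (auto simp: P'_def r_def smult_dvd_iff)
    have F: "Polynomial.degree F = r" "Polynomial.lead_coeff F = 1"
      using P'(1,2) by (simp_all add: F_def coeff_map_poly degree_map_poly)
    obtain Q' where "?B = P' * Q'" using P'(3) by (elim dvdE)
    then have "map_poly to_ac ?B = F * map_poly to_ac Q'" by (simp add: F_def map_poly_to_ac_mult)
    moreover have "map_poly to_ac ?B = Polynomial.monom 1 n - [:to_ac u:]"
      by (intro poly_eqI) (simp add: coeff_map_poly coeff_pCons split: nat.split)
    ultimately have dvd: "F dvd Polynomial.monom 1 n - [:to_ac u:]" by (metis dvd_triv_left)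
    obtain t :: "'a alg_closure" where t: "t ^ n = to_ac u"
      using alg_closed_imp_poly_has_root[of "Polynomial.monom 1 n - [:to_ac u:]"]
        degree_binomial[of n "to_ac u"] n by (auto simp: poly_monom)
    then have "t \<noteq> 0" using u n by (metis One_nat_def Suc_le_eq to_ac_eq_0_iff zero_power)
    then obtain z where z: "z ^ n = 1" "Polynomial.coeff F 0 = (-1) ^ r * z * t ^ r"
      using binomial_divisor_const_coeff[of F n t] F dvd t by auto
    define c where "c = Polynomial.coeff P' 0"
    \<comment> \<open>The \<open>n\<close>-th power removes the root of unity \<open>z\<close>, and
      injectivity of \<open>to_ac\<close> brings the identity back to \<open>k\<close>.\<close>
    have "to_ac (c ^ n) = (-1) ^ (r * n) * (t ^ n) ^ r"
      using z by (simp add: c_def F_def coeff_map_poly power_mult_distrib mult.commute flip: power_mult)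
    also have "\<dots> = to_ac ((-1) ^ (r * n) * u ^ r)" by (simp add: t)
    finally have "c ^ n = (-1) ^ (r * n) * u ^ r" by (simp only: to_ac_eq_iff)
    then have eq: "u ^ r = (-1) ^ (r * n) * c ^ n"
      by (cases "even (r * n)") auto
    obtain w w' where w: "r = p ^ multiplicity p r * w" "\<not> p dvd w"
      and w': "n = p ^ multiplicity p n * w'"
      using multiplicity_decompose'[of r p] multiplicity_decompose'[of n p] r p(1)
      by (metis not_prime_unit gr_implies_not0)
    have "u \<in> {\<zeta> * v ^ p | \<zeta> v. \<zeta> \<in> primary_roots_of_unity p \<and> v \<noteq> 0}"
    proof (rule primary_root_times_power_cancel[OF p(1) u w(2) p(2)])
      show "u ^ (p ^ multiplicity p r * w) = (-1) ^ (r * n) * c ^ (p ^ multiplicity p n * w')"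
        using eq w(1) w' by metis
      show "(-1) ^ (r * n) = (1::'a) \<or> (-1) ^ (r * n) = (-1::'a)" by (metis neg_one_even_power neg_one_odd_power)
    qed
    moreover have "p dvd n" using p(2) by (metis gr_implies_not0 not_dvd_imp_multiplicity_0)
    ultimately show False using np[OF p(1)] by blast
  qed
qed

text \<open>\<open>e\<close> is the minimum of \<open>multiplicity p n\<close> and \<open>l\<close>,
  characterised so that finite and infinite \<open>l\<close> are treated alike.\<close>

lemma gcd_prime_power_eq:
  assumes p: "Factorial_Ring.prime p" and n: "n > 0"
  obtains e where "gcd_prime_power n p l = p ^ e" "e \<le> multiplicity p n" "enat e \<le> l"
    "\<And>f. f \<le> multiplicity p n \<Longrightarrow> enat f \<le> l \<Longrightarrow> f \<le> e"
proof (cases l)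
  case (enat j)
  have p1: "p > 1" using p prime_gt_1_nat by blast
  obtain i where i: "i \<le> j" "gcd n (p ^ j) = p ^ i"
    using divides_primepow_nat[OF p, of "gcd n (p ^ j)" j] by auto
  have "p ^ i dvd n" using i(2) by (metis gcd_dvd1)
  then have "i \<le> multiplicity p n" using n p p1 by (intro multiplicity_geI) auto
  moreover have "f \<le> i" if "f \<le> multiplicity p n" "f \<le> j" for f
  proof -
    have "p ^ f dvd gcd n (p ^ j)" using that by (simp add: multiplicity_dvd' le_imp_power_dvd)
    then show ?thesis using i(2) p1 by (simp add: dvd_power_iff_le)
  qed
  ultimately show ?thesis using that[of i] enat i by (simp add: gcd_prime_power_def)
next
  case infinity
  then show ?thesis using that[of "multiplicity p n"] by (simp add: gcd_prime_power_def)
qed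

text \<open>Induction on the set of primes: by Bezout's identity \<open>z\<close> is a quotient of
  powers of \<open>z ^ p ^ e p\<close> and \<open>z ^ M\<close>, the former a root of unity for the
  remaining primes and the latter one for \<open>p\<close> alone.\<close>

lemma roots_of_unity_prod_in_field:
  fixes e :: "nat \<Rightarrow> nat" and z :: "'a::field alg_closure"
  assumes K: "intermediate_field K" and A: "finite A" "\<And>p. p \<in> A \<Longrightarrow> Factorial_Ring.prime p"
    and roots: "\<And>p z. p \<in> A \<Longrightarrow> z ^ (p ^ e p) = 1 \<Longrightarrow> z \<in> K"
    and z: "z ^ (\<Prod>p\<in>A. p ^ e p) = 1"
  shows "z \<in> K"
  using A roots z
proof (induction A arbitrary: z rule: finite_induct)
  case empty
  then show ?case using intermediate_fieldD(7)[OF K] by simp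
next
  case (insert p A)
  define M where "M = (\<Prod>p\<in>A. p ^ e p)"
  have "coprime (p ^ e p) M"
    unfolding M_def using insert by (intro prod_coprime_right) (auto intro!: primes_coprime)
  moreover have "p ^ e p \<noteq> 0" using insert.prems(1)[of p] by (auto dest: prime_gt_0_nat)
  ultimately obtain x y where xy: "p ^ e p * x = M * y + 1"
    using bezout_nat[of "p ^ e p" M] by (auto simp: coprime_iff_gcd_eq_1)
  have zM: "(z ^ M) ^ (p ^ e p) = 1" "(z ^ (p ^ e p)) ^ M = 1"
    using insert.prems(3) insert.hyps by (simp_all add: M_def mult.commute flip: power_mult)
  then have "z ^ M \<in> K" using insert.prems(2) by blast
  moreover have "z ^ (p ^ e p) \<in> K"
    using zM(2) insert unfolding M_def by blast
  moreover have "z = (z ^ (p ^ e p)) ^ x / (z ^ M) ^ y"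
  proof -
    have "z ^ M \<noteq> 0" using zM(1) \<open>p ^ e p \<noteq> 0\<close> by (metis zero_neq_one power_0_left)
    then show ?thesis using xy by (simp add: power_add flip: power_mult)
  qed
  ultimately show ?case
    using intermediate_fieldD(8,9)[OF K] by metis
qed

text \<open>\<open>N\<close> is the denominator in \<open>kummer_index\<close>. The second property
  is what Kummer theory requires for the exponent \<open>N\<close>; the third is the maximality of
  \<open>N\<close> among the divisors of \<open>n\<close> whose prime power parts respect
  \<open>lambda_exponent\<close>.\<close>

lemma kummer_index_properties:
  fixes n :: nat
  assumes n: "n > 0"
  obtains N where "n = kummer_index TYPE('a::field) n * N"
    "\<And>z :: 'a alg_closure. z ^ N = 1 \<Longrightarrow> z \<in> range to_ac"
    "\<And>d. d dvd n \<Longrightarrow> (\<And>p. Factorial_Ring.prime p \<Longrightarrow> p dvd d \<Longrightarrow>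
       enat (multiplicity p d) \<le> lambda_exponent TYPE('a) p) \<Longrightarrow> d dvd N"
proof -
  let ?l = "lambda_exponent TYPE('a)"
  define A where "A = {p. Factorial_Ring.prime p \<and> p dvd n}"
  have A: "A = prime_factors n" using n by (auto simp: A_def prime_factors_dvd)
  have "\<forall>p\<in>A. \<exists>e. gcd_prime_power n p (?l p) = p ^ e \<and> e \<le> multiplicity p n \<and> enat e \<le> ?l p \<and>
    (\<forall>f. f \<le> multiplicity p n \<longrightarrow> enat f \<le> ?l p \<longrightarrow> f \<le> e)"
    using gcd_prime_power_eq[OF _ n] unfolding A_def by (metis (no_types, lifting) mem_Collect_eq)
  then obtain e where e: "\<And>p. p \<in> A \<Longrightarrow> gcd_prime_power n p (?l p) = p ^ e p"
    "\<And>p. p \<in> A \<Longrightarrow> e p \<le> multiplicity p n" "\<And>p. p \<in> A \<Longrightarrow> enat (e p) \<le> ?l p"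
    "\<And>p f. p \<in> A \<Longrightarrow> f \<le> multiplicity p n \<Longrightarrow> enat f \<le> ?l p \<Longrightarrow> f \<le> e p"
    by metis
  define N where "N = (\<Prod>p\<in>A. p ^ e p)"
  have fin: "finite A" and prime: "\<And>p. p \<in> A \<Longrightarrow> Factorial_Ring.prime p"
    by (simp_all add: A in_prime_factors_imp_prime)
  have N0: "N \<noteq> 0" unfolding N_def using fin prime by (auto dest: prime_gt_0_nat)
  have mult: "multiplicity p N = (if p \<in> A then e p else 0)" if "Factorial_Ring.prime p" for p
    unfolding N_def using multiplicity_prod_prime_powers[OF fin prime that, of e] by simp
  have "N dvd n"
    using N0 mult e(2) by (intro multiplicity_le_imp_dvd) auto
  moreover have "kummer_index TYPE('a) n = n div N"
    unfolding kummer_index_def N_def A_def[symmetric] using e(1) by simp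
  ultimately have "n = kummer_index TYPE('a) n * N" by simp
  moreover have "z \<in> range to_ac" if "z ^ N = 1" for z :: "'a alg_closure"
  proof (rule roots_of_unity_prod_in_field[OF intermediate_field_base fin prime])
    show "z ^ (\<Prod>p\<in>A. p ^ e p) = 1" using that by (simp add: N_def)
    show "x \<in> range to_ac" if p: "p \<in> A" and x: "x ^ (p ^ e p) = 1" for p and x :: "'a alg_closure"
    proof -
      obtain y :: 'a where "primitive_root_of_unity (p ^ e p) y"
        using e(3)[OF p] lambda_exponent_ge_iff[OF prime[OF p]] by blast
      then obtain i where "x = to_ac y ^ i"
        using primitive_root_of_unity_powerE[OF _ x] primitive_root_of_unity_to_ac by blast
      then show ?thesis by (simp flip: to_ac_power)
    qed
  qed
  moreover have "d dvd N" if d: "d dvd n"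
    "\<And>p. Factorial_Ring.prime p \<Longrightarrow> p dvd d \<Longrightarrow> enat (multiplicity p d) \<le> ?l p" for d
  proof (rule multiplicity_le_imp_dvd)
    show "d \<noteq> 0" using d(1) n by auto
    fix p assume p: "Factorial_Ring.prime (p::nat)"
    show "multiplicity p d \<le> multiplicity p N"
    proof (cases "p dvd d")
      case True
      then have "p \<in> A" using p d(1) dvd_trans by (auto simp: A_def)
      moreover have "multiplicity p d \<le> multiplicity p n"
        using d(1) n by (intro dvd_imp_multiplicity_le) auto
      ultimately show ?thesis using e(4) d(2)[OF p True] mult[OF p] by simp
    qed (simp add: not_dvd_imp_multiplicity_0)
  qed
  ultimately show ?thesis using that by blast
qed

theorem proposition2p1:
  fixes u :: "'a::field" and n :: nat
  assumes "n \<ge> 1"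
    and "CHAR('a) = 0 \<or> coprime n CHAR('a)"
    and "u \<noteq> 0"
    and "\<And>p. Factorial_Ring.prime p \<Longrightarrow> p dvd n \<Longrightarrow>
           u \<notin> {\<zeta> * v ^ p | \<zeta> v. \<zeta> \<in> primary_roots_of_unity p \<and> v \<noteq> 0}"
  shows "Factorial_Ring.irreducible (Polynomial.monom 1 n - [:u:]) \<and>
         (\<forall>t :: 'a alg_closure. t ^ n = to_ac u \<longrightarrow>
            adjoin t \<inter> maximal_abelian_extension = adjoin (t ^ kummer_index TYPE('a) n))"
proof (intro conjI allI impI)
  show "Factorial_Ring.irreducible (Polynomial.monom 1 n - [:u:])"
    using binomial_irreducible assms(1,3,4) by blast
  fix t :: "'a alg_closure" assume t: "t ^ n = to_ac u"
  have n0: "n > 0" using assms(1) by simp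
  have nk: "of_nat n \<noteq> (0::'a)"
  proof
    assume "of_nat n = (0::'a)"
    then have "CHAR('a) dvd n" by (simp add: of_nat_eq_0_iff_char_dvd)
    then have "CHAR('a) = 1" using assms(2) n0 by (metis coprime_absorb_right dvd_0_left_iff gr_implies_not0 nat_dvd_1_iff_1)
    then show False by (metis of_nat_1 of_nat_CHAR zero_neq_one)
  qed
  have dvd_nk: "of_nat d \<noteq> (0::'a)" if "d dvd n" for d
    using nk that by auto
  have t0: "t \<noteq> 0" using t assms(3) n0 by (metis to_ac_eq_0_iff zero_power)
  let ?M = "maximal_abelian_extension :: 'a alg_closure set"
  note M = intermediate_field_maximal_abelian[where 'a='a]
  define m where "m = kummer_index TYPE('a) n"
  obtain N where N: "n = m * N" "\<And>z :: 'a alg_closure. z ^ N = 1 \<Longrightarrow> z \<in> range to_ac"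
    "\<And>d. d dvd n \<Longrightarrow> (\<And>p. Factorial_Ring.prime p \<Longrightarrow> p dvd d \<Longrightarrow>
       enat (multiplicity p d) \<le> lambda_exponent TYPE('a) p) \<Longrightarrow> d dvd N"
    using kummer_index_properties[OF n0, where 'a='a] unfolding m_def by metis
  have m0: "m > 0" and N0: "N > 0" using N(1) n0 by (auto intro: gr0I)
  let ?K = "adjoin (t ^ m)"
  \<comment> \<open>Kummer theory applies to \<open>t ^ m\<close> as an \<open>N\<close>-th root of
    \<open>u\<close>; this yields one inclusion.\<close>
  have "(t ^ m) ^ N = to_ac u" using t N(1) by (simp flip: power_mult)
  then have "abelian_extension ?K"
    using abelian_adjoin_kummer[OF _ assms(3) dvd_nk N(2)] N(1) by simp
  then have KM: "?K \<subseteq> ?M" by (rule abelian_subset_maximal)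
  have Kt: "?K \<subseteq> adjoin t"
    by (intro adjoin_least intermediate_field_adjoin intermediate_fieldD(8) adjoin_self)
  define L where "L = adjoin t \<inter> ?M"
  have L: "intermediate_field L"
    unfolding L_def using intermediate_field_Int[OF intermediate_field_adjoin M] .
  obtain F where F: "minimal_pair (Id_on L) t F F" using minimal_polynomial_exists[OF L] .
  note FD = minimal_polynomialD[OF F]
  \<comment> \<open>The degree of \<open>t\<close> over \<open>L\<close>; the aim is
    \<open>m \<le> e\<close>.\<close>
  define e where "e = Polynomial.degree F"
  have e0: "e > 0" using FD(5) by (simp add: e_def)
  have "F dvd Polynomial.monom 1 n - [:t ^ n:]"
    by (rule minimal_polynomial_dvd_binomial[OF F L]) (simp add: t intermediate_fieldD(1)[OF L])
  then obtain z where z: "z ^ n = 1" "Polynomial.coeff F 0 = (-1) ^ e * z * t ^ e"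
    using binomial_divisor_const_coeff[OF FD(2) _ t0] by (auto simp: e_def)
  \<comment> \<open>Dividing the constant coefficient by the sign and by the root of unity
    \<open>z\<close>, which is abelian over \<open>k\<close>, leaves \<open>t ^ e\<close>.\<close>
  have "Polynomial.coeff F 0 \<in> ?M" using poly_overD[OF FD(1), of 0] by (simp add: L_def)
  moreover have zM: "z \<in> ?M" using root_of_unity_in_maximal_abelian[OF z(1) nk] .
  moreover have "(-1) ^ e \<in> ?M" using intermediate_fieldD(4,7,8)[OF M] by blast
  moreover have "z \<noteq> 0" using z(1) n0 by (auto simp: zero_power)
  then have "t ^ e = Polynomial.coeff F 0 / ((-1) ^ e * z)" using z(2) by simp
  ultimately have te: "t ^ e \<in> ?M" using intermediate_fieldD(3,9)[OF M] by metis
  \<comment> \<open>Bezout's identity and \<open>t ^ n = u\<close> lower the exponent from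
    \<open>e\<close> to a divisor \<open>g\<close> of \<open>n\<close>, which makes
    \<open>t ^ g\<close> a radical of \<open>u\<close> of exponent \<open>d\<close>, where
    \<open>n = g * d\<close>.\<close>
  define g where "g = gcd e n"
  obtain x y where "e * x = n * y + g" using bezout_nat[of e n] e0 by (auto simp: g_def)
  then have "(t ^ e) ^ x = to_ac u ^ y * t ^ g"
    by (metis power_add power_mult t)
  then have "t ^ g = (t ^ e) ^ x / to_ac u ^ y"
    using assms(3) by simp
  then have tg: "t ^ g \<in> ?M"
    using te intermediate_fieldD(1,8,9)[OF M] by metis
  obtain d where d: "n = g * d" unfolding g_def by (metis dvdE gcd_dvd2)
  have "d dvd N"
  proof (rule N(3))
    show "d dvd n" by (simp add: d)
    fix p assume p: "Factorial_Ring.prime p" "p dvd d"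
    have pn: "p dvd n" using p(2) by (simp add: d)
    \<comment> \<open>Raising \<open>t ^ g\<close> to the cofactor \<open>d'\<close> gives a radical
      of \<open>u\<close> of \<open>p\<close>-power exponent in the maximal abelian extension, to
      which the bound by \<open>lambda_exponent\<close> applies.\<close>
    obtain d' where d': "d = p ^ multiplicity p d * d'" using multiplicity_dvd by (metis dvdE)
    show "enat (multiplicity p d) \<le> lambda_exponent TYPE('a) p"
    proof (rule radical_in_maximal_abelian[OF p(1) dvd_nk[OF pn] assms(3) assms(4)[OF p(1) pn]])
      have "(t ^ g) ^ d' \<in> ?M" by (rule intermediate_fieldD(8)[OF M tg])
      then show "t ^ (g * d') \<in> ?M" by (simp add: power_mult)
      have "n = g * d' * p ^ multiplicity p d" using d d' by (metis mult.assoc mult.commute)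
      then show "(t ^ (g * d')) ^ p ^ multiplicity p d = to_ac u" using t by (simp flip: power_mult)
    qed
  qed
  then obtain k where "N = d * k" by (elim dvdE)
  then have "g * d = m * k * d" using N(1) d by (metis mult.assoc mult.commute)
  moreover have "d \<noteq> 0" using d n0 by auto
  ultimately have "g = m * k" by simp
  then have "m dvd e" unfolding g_def by (metis dvd_triv_left dvd_trans gcd_dvd1)
  then have me: "m \<le> e" using e0 by (auto dest: dvd_imp_le)
  have tK: "t ^ m \<in> ?K" by (rule adjoin_self)
  have "L \<subseteq> ?K"
  proof
    fix x assume x: "x \<in> L"
    obtain P where P: "poly_over (range to_ac) P" "x = poly P t" using x by (auto simp: L_def adjoin_eq)
    let ?B = "Polynomial.monom 1 m - [:t ^ m:]"
    note Kf = intermediate_field_adjoin[of "t ^ m"]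
    have Kh: "partial_hom (Id_on ?K)" using Kf by (simp add: intermediate_field_iff_partial_hom)
    have "poly_over ?K P" using P(1) Kf unfolding intermediate_field_def by (auto simp: coeffs_rel_Id_on)
    \<comment> \<open>The binomial vanishes at \<open>t\<close>, so \<open>x\<close> is also the
      value at \<open>t\<close> of the remainder \<open>R\<close>, which has coefficients in
      \<open>?K\<close> and degree below \<open>m \<le> e\<close>.\<close>
    then obtain A R where AR: "P = ?B * A + R" "poly_over ?K R" "Polynomial.degree R < Polynomial.degree ?B"
      using coeffs_rel_division[OF Kh poly_over_binomial[OF Kf tK, of m], of P P] lead_coeff_binomial[OF m0, of "t ^ m"]
        degree_binomial[OF m0, of "t ^ m"] m0 by (auto simp: coeffs_rel_Id_on)
    have "poly (R - [:x:]) t = 0" using P(2) AR(1) by (simp add: poly_monom)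
    moreover have "poly_over L (R - [:x:])"
    proof -
      have Lh: "partial_hom (Id_on L)" using L by (simp add: intermediate_field_iff_partial_hom)
      have "poly_over L R" using AR(2) Kt KM by (auto simp: coeffs_rel_Id_on L_def)
      then show ?thesis
        using coeffs_rel_diff[OF Lh] coeffs_rel_pCons[OF Lh Id_onI[OF x] coeffs_rel_0[OF Lh]] by blast
    qed
    \<comment> \<open>Over \<open>L\<close> no nonzero polynomial of degree below \<open>e\<close>
      vanishes at \<open>t\<close>, so \<open>x\<close> is the constant coefficient of
      \<open>R\<close>.\<close>
    ultimately have "F dvd R - [:x:]" by (intro FD(4))
    moreover have "Polynomial.degree (R - [:x:]) < e"
      using AR(3) me degree_binomial[OF m0, of "t ^ m"] m0 by (intro degree_diff_less) auto
    ultimately have "R - [:x:] = 0" unfolding e_def by (meson dvd_imp_degree_le not_le)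
    then have "R = [:x:]" by simp
    then show "x \<in> ?K" using poly_overD[OF AR(2), of 0] by simp
  qed
  then show "adjoin t \<inter> ?M = adjoin (t ^ kummer_index TYPE('a) n)"
    using Kt KM unfolding L_def m_def by blast
qed

end
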